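(* Let $R$ be a commutative ring with unit, let $i\in\{1,\dots,6\}$, and let $M$ be a free $R$-module of finite type endowed with a $G_i$-associative algebra structure. Then the dual $M^{*}$ of the $R$-module $M$ is a $G_i$-coalgebra.
   Context: All tensor products are over $R$, and $M^{*}=Hom_R(M,R)$. $\Sigma_3$ is the symmetric group on $\{1,2,3\}$, $(-1)^{\epsilon(\sigma)}$ is the sign of $\sigma$, $\tau_{jk}$ is the transposition exchanging $j$ and $k$, and $c_1,c_2$ are the two $3$-cycles. The subgroups of $\Sigma_3$ are denoted $G_1=\{Id\}$, $G_2=\{Id,\tau_{12}\}$, $G_3=\{Id,\tau_{23}\}$, $G_4=\{Id,\tau_{13}\}$, $G_5=\{Id,c_1,c_2\}$, $G_6=\Sigma_3$. For an $R$-module $N$ and $\sigma\in\Sigma_3$, $\Phi^N_\sigma : N^{\otimes 3}\to N^{\otimes 3}$ is the linear map with $\Phi^N_\sigma(x_1\otimes x_2\otimes x_3)=x_{\sigma^{-1}(1)}\otimes x_{\sigma^{-1}(2)}\otimes x_{\sigma^{-1}(3)}$, and $\Phi^N_{G_i}=\sum_{\sigma\in G_i}(-1)^{\epsilon(\sigma)}\Phi^N_\sigma$. A multiplication $\mu : N\otimes N\to N$ ($R$-linear) on an $R$-module $N$ is $G_i$-associative if $A(\mu)\circ\Phi^N_{G_i}=0$, where $A(\mu)=\mu\circ(\mu\otimes Id)-\mu\circ(Id\otimes\mu)$; then $(N,\mu)$ is a $G_i$-associative algebra. A $G_i$-coalgebra is an $R$-module $N$ endowed with a comultiplication, i.e.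 an $R$-linear map $\Delta : N\to N\otimes N$, such that $\sum_{\sigma\in G_i}(-1)^{\epsilon(\sigma)}\Phi^N_\sigma\circ\tilde A(\Delta)=0$, where $\tilde A(\Delta)=(\Delta\otimes Id)\circ\Delta-(Id\otimes\Delta)\circ\Delta$. *)

theory Defs
  imports
    "HOL-Algebra.AbelCoset"
    "HOL-Combinatorics.Combinatorics"
    "Jordan_Normal_Form.Missing_VectorSpace"
begin

text \<open>
  Modules are those of HOL-Algebra, linear maps are the elements of \<open>module_hom\<close>, and linear
  independence and spans over an arbitrary commutative ring are those of the theory
  LinearCombinations. The record of a module inherits from that of a ring the fields \<open>mult\<close> and
  \<open>one\<close>, which play no role in a module; they are left unspecified below.
\<close>

definition free_of_finite_type :: "('a, 'k) ring_scheme \<Rightarrow> ('a, 'b, 'm) module_scheme \<Rightarrow> bool"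
  where "free_of_finite_type R M \<longleftrightarrow>
    (\<exists>B \<subseteq> carrier M. finite B \<and> \<not> LinearCombinations.module.lin_dep R M B \<and>
      LinearCombinations.module.span R M B = carrier M)"

definition regular_module :: "('a, 'k) ring_scheme \<Rightarrow> ('a, 'a) module"
  where "regular_module R =
    \<lparr>carrier = carrier R, monoid.mult = undefined, one = undefined,
     zero = \<zero>\<^bsub>R\<^esub>, add = (\<oplus>\<^bsub>R\<^esub>), smult = (\<otimes>\<^bsub>R\<^esub>)\<rparr>"

text \<open>
  Maps on a carrier are made extensional wherever they have to be unique as HOL functions,
  in particular as elements of \<open>Hom\<close> modules.
\<close>

definition dual_module :: "('a, 'k) ring_scheme \<Rightarrow> ('a, 'b, 'm) module_scheme \<Rightarrow> ('a, 'b \<Rightarrow> 'a) module"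
  where "dual_module R M =
    \<lparr>carrier = module_hom R M (regular_module R) \<inter> extensional (carrier M),
     monoid.mult = undefined, one = undefined,
     zero = (\<lambda>x\<in>carrier M. \<zero>\<^bsub>R\<^esub>),
     add = (\<lambda>f g. \<lambda>x\<in>carrier M. f x \<oplus>\<^bsub>R\<^esub> g x),
     smult = (\<lambda>r f. \<lambda>x\<in>carrier M. r \<otimes>\<^bsub>R\<^esub> f x)\<rparr>"


subsection \<open>The tensor product of two modules\<close>

definition free_module :: "('a, 'k) ring_scheme \<Rightarrow> 'b set \<Rightarrow> ('a, 'b \<Rightarrow> 'a) module"
  where "free_module R S =
    \<lparr>carrier = {f. f \<in> S \<rightarrow> carrier R \<and> (\<forall>x. x \<notin> S \<longrightarrow> f x = \<zero>\<^bsub>R\<^esub>) \<and> finite {x. f x \<noteq> \<zero>\<^bsub>R\<^esub>}},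
     monoid.mult = undefined, one = undefined,
     zero = (\<lambda>x. \<zero>\<^bsub>R\<^esub>),
     add = (\<lambda>f g x. f x \<oplus>\<^bsub>R\<^esub> g x),
     smult = (\<lambda>r f x. r \<otimes>\<^bsub>R\<^esub> f x)\<rparr>"

definition free_gen :: "('a, 'k) ring_scheme \<Rightarrow> 'b \<Rightarrow> 'b \<Rightarrow> 'a"
  where "free_gen R p = (\<lambda>q. if q = p then \<one>\<^bsub>R\<^esub> else \<zero>\<^bsub>R\<^esub>)"

definition quotient_module :: "('a, 'b, 'm) module_scheme \<Rightarrow> 'b set \<Rightarrow> ('a, 'b set) module"
  where "quotient_module F K =
    \<lparr>carrier = a_rcosets\<^bsub>F\<^esub> K, monoid.mult = undefined, one = undefined,
     zero = K, add = (<+>\<^bsub>F\<^esub>),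
     smult = (\<lambda>r X. \<Union>x\<in>X. K +>\<^bsub>F\<^esub> (r \<odot>\<^bsub>F\<^esub> x))\<rparr>"

definition bilinear_relations ::
    "('a, 'k) ring_scheme \<Rightarrow> ('a, 'b, 'm) module_scheme \<Rightarrow> ('a, 'c, 'n) module_scheme
      \<Rightarrow> ('b \<times> 'c \<Rightarrow> 'a) set"
  where "bilinear_relations R M N =
    (let F = free_module R (carrier M \<times> carrier N); e = (\<lambda>x y. free_gen R (x, y)) in
      {e (x \<oplus>\<^bsub>M\<^esub> x') y \<ominus>\<^bsub>F\<^esub> (e x y \<oplus>\<^bsub>F\<^esub> e x' y) | x x' y.
         x \<in> carrier M \<and> x' \<in> carrier M \<and> y \<in> carrier N}
    \<union> {e x (y \<oplus>\<^bsub>N\<^esub> y') \<ominus>\<^bsub>F\<^esub> (e x y \<oplus>\<^bsub>F\<^esub> e x y') | x y y'.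
         x \<in> carrier M \<and> y \<in> carrier N \<and> y' \<in> carrier N}
    \<union> {e (r \<odot>\<^bsub>M\<^esub> x) y \<ominus>\<^bsub>F\<^esub> r \<odot>\<^bsub>F\<^esub> e x y | r x y.
         r \<in> carrier R \<and> x \<in> carrier M \<and> y \<in> carrier N}
    \<union> {e x (r \<odot>\<^bsub>N\<^esub> y) \<ominus>\<^bsub>F\<^esub> r \<odot>\<^bsub>F\<^esub> e x y | r x y.
         r \<in> carrier R \<and> x \<in> carrier M \<and> y \<in> carrier N})"

definition bilinear_submodule ::
    "('a, 'k) ring_scheme \<Rightarrow> ('a, 'b, 'm) module_scheme \<Rightarrow> ('a, 'c, 'n) module_scheme
      \<Rightarrow> ('b \<times> 'c \<Rightarrow> 'a) set"
  where "bilinear_submodule R M N =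
    LinearCombinations.module.span R (free_module R (carrier M \<times> carrier N)) (bilinear_relations R M N)"

definition tensor_product ::
    "('a, 'k) ring_scheme \<Rightarrow> ('a, 'b, 'm) module_scheme \<Rightarrow> ('a, 'c, 'n) module_scheme
      \<Rightarrow> ('a, ('b \<times> 'c \<Rightarrow> 'a) set) module"
  where "tensor_product R M N =
    quotient_module (free_module R (carrier M \<times> carrier N)) (bilinear_submodule R M N)"

definition tensor ::
    "('a, 'k) ring_scheme \<Rightarrow> ('a, 'b, 'm) module_scheme \<Rightarrow> ('a, 'c, 'n) module_scheme
      \<Rightarrow> 'b \<Rightarrow> 'c \<Rightarrow> ('b \<times> 'c \<Rightarrow> 'a) set"
  where "tensor R M N x y =
    bilinear_submodule R M N +>\<^bsub>free_module R (carrier M \<times> carrier N)\<^esub> free_gen R (x, y)"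

text \<open>
  \<open>tensor_lift R M N P b\<close> is the linear map out of the tensor product that sends each
  \<open>x \<otimes> y\<close> to \<open>b x y\<close>; it is meaningful if \<open>b\<close> is bilinear.
\<close>

definition tensor_lift ::
    "('a, 'k) ring_scheme \<Rightarrow> ('a, 'b, 'm) module_scheme \<Rightarrow> ('a, 'c, 'n) module_scheme
      \<Rightarrow> ('a, 'd, 'p) module_scheme \<Rightarrow> ('b \<Rightarrow> 'c \<Rightarrow> 'd) \<Rightarrow> ('b \<times> 'c \<Rightarrow> 'a) set \<Rightarrow> 'd"
  where "tensor_lift R M N P b =
    (THE h. h \<in> module_hom R (tensor_product R M N) P \<inter> extensional (carrier (tensor_product R M N)) \<and>
      (\<forall>x\<in>carrier M. \<forall>y\<in>carrier N. h (tensor R M N x y) = b x y))"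

text \<open>The map \<open>f \<otimes> g\<close> from the tensor product of \<open>M\<close> and \<open>N\<close> to that of \<open>M'\<close> and \<open>N'\<close>.\<close>

definition tensor_map ::
    "('a, 'k) ring_scheme \<Rightarrow> ('a, 'b, 'm) module_scheme \<Rightarrow> ('a, 'c, 'n) module_scheme
      \<Rightarrow> ('a, 'd, 'p) module_scheme \<Rightarrow> ('a, 'e, 'q) module_scheme
      \<Rightarrow> ('b \<Rightarrow> 'd) \<Rightarrow> ('c \<Rightarrow> 'e) \<Rightarrow> ('b \<times> 'c \<Rightarrow> 'a) set \<Rightarrow> ('d \<times> 'e \<Rightarrow> 'a) set"
  where "tensor_map R M N M' N' f g =
    tensor_lift R M N (tensor_product R M' N') (\<lambda>x y. tensor R M' N' (f x) (g y))"


subsection \<open>The third tensor power\<close>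

type_synonym ('a, 'b) tensor2 = "('b \<times> 'b \<Rightarrow> 'a) set"
type_synonym ('a, 'b) tensor3 = "(('a, 'b) tensor2 \<times> 'b \<Rightarrow> 'a) set"

text \<open>
  \<open>N\<^sup>\<otimes>\<^sup>3\<close> is bracketed to the left; the identification with the other bracketing is the explicit
  isomorphism \<open>tensor_assoc\<close>.
\<close>

definition tensor_cube :: "('a, 'k) ring_scheme \<Rightarrow> ('a, 'b, 'm) module_scheme \<Rightarrow> ('a, ('a, 'b) tensor3) module"
  where "tensor_cube R N = tensor_product R (tensor_product R N N) N"

definition tensor_triple ::
    "('a, 'k) ring_scheme \<Rightarrow> ('a, 'b, 'm) module_scheme \<Rightarrow> 'b \<Rightarrow> 'b \<Rightarrow> 'b \<Rightarrow> ('a, 'b) tensor3"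
  where "tensor_triple R N x y z = tensor R (tensor_product R N N) N (tensor R N N x y) z"

definition tensor_cube_lift ::
    "('a, 'k) ring_scheme \<Rightarrow> ('a, 'b, 'm) module_scheme \<Rightarrow> ('a, 'd, 'p) module_scheme
      \<Rightarrow> ('b \<Rightarrow> 'b \<Rightarrow> 'b \<Rightarrow> 'd) \<Rightarrow> ('a, 'b) tensor3 \<Rightarrow> 'd"
  where "tensor_cube_lift R N P t =
    (THE h. h \<in> module_hom R (tensor_cube R N) P \<inter> extensional (carrier (tensor_cube R N)) \<and>
      (\<forall>x\<in>carrier N. \<forall>y\<in>carrier N. \<forall>z\<in>carrier N. h (tensor_triple R N x y z) = t x y z))"

definition tensor_assoc ::
    "('a, 'k) ring_scheme \<Rightarrow> ('a, 'b, 'm) module_scheme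
      \<Rightarrow> ('a, 'b) tensor3 \<Rightarrow> ('b \<times> ('a, 'b) tensor2 \<Rightarrow> 'a) set"
  where "tensor_assoc R N =
    tensor_cube_lift R N (tensor_product R N (tensor_product R N N))
      (\<lambda>x y z. tensor R N (tensor_product R N N) x (tensor R N N y z))"

definition tensor_assoc_inv ::
    "('a, 'k) ring_scheme \<Rightarrow> ('a, 'b, 'm) module_scheme
      \<Rightarrow> ('b \<times> ('a, 'b) tensor2 \<Rightarrow> 'a) set \<Rightarrow> ('a, 'b) tensor3"
  where "tensor_assoc_inv R N = inv_into (carrier (tensor_cube R N)) (tensor_assoc R N)"


subsection \<open>The action of the symmetric group\<close>

definition sigma3_subgroup :: "nat \<Rightarrow> (nat \<Rightarrow> nat) set"
  where "sigma3_subgroup i =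
    [{id},
     {id, Transposition.transpose 1 2},
     {id, Transposition.transpose 2 3},
     {id, Transposition.transpose 1 3},
     {id, cycle_of_list [1, 2, 3], cycle_of_list [1, 3, 2]},
     {\<sigma>. \<sigma> permutes {1, 2, 3}}] ! (i - 1)"

text \<open>
  The inverse of a permutation is written \<open>inv_into UNIV\<close> since \<open>inv\<close> denotes the inverse in a
  group here.
\<close>

definition perm_map ::
    "('a, 'k) ring_scheme \<Rightarrow> ('a, 'b, 'm) module_scheme \<Rightarrow> (nat \<Rightarrow> nat)
      \<Rightarrow> ('a, 'b) tensor3 \<Rightarrow> ('a, 'b) tensor3"
  where "perm_map R N \<sigma> = tensor_cube_lift R N (tensor_cube R N)
    (\<lambda>x\<^sub>1 x\<^sub>2 x\<^sub>3. let x = (\<lambda>k. [x\<^sub>1, x\<^sub>2, x\<^sub>3] ! (k - 1)); \<tau> = inv_into UNIV \<sigma>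
       in tensor_triple R N (x (\<tau> 1)) (x (\<tau> 2)) (x (\<tau> 3)))"

definition alternating_map ::
    "('a, 'k) ring_scheme \<Rightarrow> ('a, 'b, 'm) module_scheme \<Rightarrow> (nat \<Rightarrow> nat) set
      \<Rightarrow> ('a, 'b) tensor3 \<Rightarrow> ('a, 'b) tensor3"
  where "alternating_map R N G t =
    (\<Oplus>\<^bsub>tensor_cube R N\<^esub> \<sigma>\<in>G. [sign \<sigma>] \<cdot>\<^bsub>tensor_cube R N\<^esub> perm_map R N \<sigma> t)"


subsection \<open>\<open>G\<close>-associative algebras and \<open>G\<close>-coalgebras\<close>

definition associator ::
    "('a, 'k) ring_scheme \<Rightarrow> ('a, 'b, 'm) module_scheme \<Rightarrow> (('a, 'b) tensor2 \<Rightarrow> 'b)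
      \<Rightarrow> ('a, 'b) tensor3 \<Rightarrow> 'b"
  where "associator R N \<mu> t =
    \<mu> (tensor_map R (tensor_product R N N) N N N \<mu> id t) \<ominus>\<^bsub>N\<^esub>
    \<mu> (tensor_map R N (tensor_product R N N) N N id \<mu> (tensor_assoc R N t))"

definition G_associative_algebra ::
    "('a, 'k) ring_scheme \<Rightarrow> (nat \<Rightarrow> nat) set \<Rightarrow> ('a, 'b, 'm) module_scheme
      \<Rightarrow> (('a, 'b) tensor2 \<Rightarrow> 'b) \<Rightarrow> bool"
  where "G_associative_algebra R G N \<mu> \<longleftrightarrow>
    module R N \<and> \<mu> \<in> module_hom R (tensor_product R N N) N \<and>
    (\<forall>t\<in>carrier (tensor_cube R N). associator R N \<mu> (alternating_map R N G t) = \<zero>\<^bsub>N\<^esub>)"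

definition coassociator ::
    "('a, 'k) ring_scheme \<Rightarrow> ('a, 'b, 'm) module_scheme \<Rightarrow> ('b \<Rightarrow> ('a, 'b) tensor2)
      \<Rightarrow> 'b \<Rightarrow> ('a, 'b) tensor3"
  where "coassociator R N \<Delta> x =
    tensor_map R N N (tensor_product R N N) N \<Delta> id (\<Delta> x) \<ominus>\<^bsub>tensor_cube R N\<^esub>
    tensor_assoc_inv R N (tensor_map R N N N (tensor_product R N N) id \<Delta> (\<Delta> x))"

definition G_coalgebra ::
    "('a, 'k) ring_scheme \<Rightarrow> (nat \<Rightarrow> nat) set \<Rightarrow> ('a, 'b, 'm) module_scheme
      \<Rightarrow> ('b \<Rightarrow> ('a, 'b) tensor2) \<Rightarrow> bool"
  where "G_coalgebra R G N \<Delta> \<longleftrightarrow>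
    module R N \<and> \<Delta> \<in> module_hom R N (tensor_product R N N) \<and>
    (\<forall>x\<in>carrier N. alternating_map R N G (coassociator R N \<Delta> x) = \<zero>\<^bsub>tensor_cube R N\<^esub>)"


subsection \<open>The comultiplication dual to a multiplication\<close>

text \<open>The canonical map \<open>M\<^sup>* \<otimes> M\<^sup>* \<rightarrow> (M \<otimes> M)\<^sup>*\<close>, which sends \<open>f \<otimes> g\<close> to \<open>x \<otimes> y \<mapsto> f x g y\<close>.\<close>

definition dual_tensor_map ::
    "('a, 'k) ring_scheme \<Rightarrow> ('a, 'b, 'm) module_scheme
      \<Rightarrow> ('a, 'b \<Rightarrow> 'a) tensor2 \<Rightarrow> ('a, 'b) tensor2 \<Rightarrow> 'a"
  where "dual_tensor_map R M =
    tensor_lift R (dual_module R M) (dual_module R M) (dual_module R (tensor_product R M M))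
      (\<lambda>f g. tensor_lift R M M (regular_module R) (\<lambda>x y. f x \<otimes>\<^bsub>R\<^esub> g y))"

definition transpose_map ::
    "('a, 'b, 'm) module_scheme \<Rightarrow> ('b \<Rightarrow> 'c) \<Rightarrow> ('c \<Rightarrow> 'a) \<Rightarrow> 'b \<Rightarrow> 'a"
  where "transpose_map M h f = (\<lambda>x\<in>carrier M. f (h x))"

text \<open>The comultiplication is meaningful if the canonical map is bijective.\<close>

definition dual_comult ::
    "('a, 'k) ring_scheme \<Rightarrow> ('a, 'b, 'm) module_scheme \<Rightarrow> (('a, 'b) tensor2 \<Rightarrow> 'b)
      \<Rightarrow> ('b \<Rightarrow> 'a) \<Rightarrow> ('a, 'b \<Rightarrow> 'a) tensor2"
  where "dual_comult R M \<mu> f =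
    inv_into (carrier (tensor_product R (dual_module R M) (dual_module R M))) (dual_tensor_map R M)
      (transpose_map (tensor_product R M M) \<mu> f)"

end

theory Submission
  imports Defs
begin

text \<open>
  The only consequence of freeness that is used is the existence of a finite dual basis
  \<open>x = (\<Sum>b\<in>B. \<delta> b x \<odot> b)\<close>. Contracting the last factor of \<open>N \<otimes> M\<^sup>*\<close> with
  a vector \<open>z\<close> of \<open>M\<close> gives a linear map to \<open>N\<close>, and \<open>t = (\<Sum>b\<in>B. contract b t \<otimes> \<delta> b)\<close>, so a
  tensor is determined by its contractions. Iterating, a tensor in the second or third tensor power
  of \<open>M\<^sup>*\<close> is determined by its values at the vectors of \<open>M\<close>. The value of the
  coassociator of \<open>f\<close> at \<open>(x, y, z)\<close> is \<open>f\<close> applied to the associator of \<open>x \<otimes> y \<otimes> z\<close>, and the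
  action of \<open>\<sigma>\<close> on \<open>M\<^sup>*\<close> is transposed to that of its inverse on \<open>M\<close>. Since a subgroup is
  closed under inversion, which preserves signs, the two alternating sums are transposes of each
  other.
\<close>

section \<open>Linear maps\<close>

text \<open>Only for two factors is the canonical map from tensors of forms to forms on tensors
  inverted, because \<Delta> is defined by that inverse. For three factors no inverse is formed: the
  coalgebra identity only needs that evaluations separate tensors. The obstacle is that the objects
  are given by choice. A lift is a definite description, and both \<Delta> and the return from the
  other bracketing are values of \<open>inv_into\<close>. Each is therefore first pinned down by a
  formula. For \<Delta> it says that contracting \<open>\<Delta> f\<close> with \<open>y\<close> and
  evaluating at \<open>x\<close> gives \<open>f (\<mu> (x \<otimes> y))\<close>; this and linearity
  are all that the coalgebra identity takes from \<Delta>. The two halves of the coassociator are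
  not symmetric. The left half is already bracketed for contraction in the last factor, and there
  contraction commutes with \<Delta>. The right half must first pass through the inverse of the
  associativity isomorphism; after that, contracting with \<open>z\<close> and then \<open>y\<close>
  amounts to one contraction with the product of \<open>y\<close> and \<open>z\<close>.\<close>

lemma module_homI:
  assumes "\<And>x. x \<in> carrier M \<Longrightarrow> f x \<in> carrier N"
    and "\<And>x y. x \<in> carrier M \<Longrightarrow> y \<in> carrier M \<Longrightarrow> f (x \<oplus>\<^bsub>M\<^esub> y) = f x \<oplus>\<^bsub>N\<^esub> f y"
    and "\<And>r x. r \<in> carrier R \<Longrightarrow> x \<in> carrier M \<Longrightarrow> f (r \<odot>\<^bsub>M\<^esub> x) = r \<odot>\<^bsub>N\<^esub> f x"
  shows "f \<in> module_hom R M N"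
  using assms by (auto simp: module_hom_def)

lemma module_hom_closedD: "f \<in> module_hom R M N \<Longrightarrow> x \<in> carrier M \<Longrightarrow> f x \<in> carrier N"
  by (auto simp: module_hom_def)

lemma mod_homI: "module R M \<Longrightarrow> module R N \<Longrightarrow> f \<in> module_hom R M N \<Longrightarrow> mod_hom R M N f"
  by (simp add: mod_hom_def mod_hom_axioms_def)

lemma module_hom_cong:
  assumes "module R M" and "\<And>x. x \<in> carrier M \<Longrightarrow> f x = g x"
  shows "f \<in> module_hom R M N \<longleftrightarrow> g \<in> module_hom R M N"
proof -
  interpret module R M by fact
  show ?thesis using assms(2) by (auto simp: module_hom_def Pi_iff)
qed

lemma module_hom_restrict:
  assumes "module R M" and "f \<in> module_hom R M N"
  shows "restrict f (carrier M) \<in> module_hom R M N"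
  using assms(2) by (simp add: module_hom_cong[OF assms(1), of "restrict f (carrier M)" f])

lemma module_hom_id: "id \<in> module_hom R M M"
  by (auto intro: module_homI)

lemma module_hom_compose:
  assumes "f \<in> module_hom R M N" and "g \<in> module_hom R N P"
  shows "(\<lambda>x. g (f x)) \<in> module_hom R M P"
  using assms by (auto simp: module_hom_def Pi_iff)

lemma module_hom_zero:
  assumes "module R M" and "module R N" and "f \<in> module_hom R M N"
  shows "f \<zero>\<^bsub>M\<^esub> = \<zero>\<^bsub>N\<^esub>"
  using mod_hom.f0_is_0[OF mod_homI[OF assms]] .

lemma module_hom_diff:
  assumes "module R M" and "module R N" and "f \<in> module_hom R M N"
    and "x \<in> carrier M" and "y \<in> carrier M"
  shows "f (x \<ominus>\<^bsub>M\<^esub> y) = f x \<ominus>\<^bsub>N\<^esub> f y"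
  using mod_hom.f_minus[OF mod_homI[OF assms(1-3)] assms(4,5)] .

lemma module_hom_finsum:
  assumes "module R M" and "module R N" and f: "f \<in> module_hom R M N"
    and "g \<in> A \<rightarrow> carrier M"
  shows "f (finsum M g A) = (\<Oplus>\<^bsub>N\<^esub>a\<in>A. f (g a))"
proof -
  interpret mod_hom R M N f
    using mod_homI[OF assms(1-3)] .
  show ?thesis
    using assms(4)
  proof (induction A rule: infinite_finite_induct)
    case (insert a A)
    then have "(\<lambda>a. f (g a)) \<in> A \<rightarrow> carrier N" by auto
    with insert show ?case by (simp add: Pi_iff)
  qed simp_all
qed

text \<open>The signs in \<open>alternating_map\<close> act as integer multiples in the additive
  group, not as scalars of \<open>R\<close>, so linear maps have to be moved past them
  separately.\<close>

lemma module_hom_int_multiple: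
  fixes k :: int
  assumes "module R M" and "module R N" and f: "f \<in> module_hom R M N" and x: "x \<in> carrier M"
  shows "f ([k] \<cdot>\<^bsub>M\<^esub> x) = [k] \<cdot>\<^bsub>N\<^esub> f x"
proof -
  interpret mod_hom R M N f
    using mod_homI[OF assms(1-3)] .
  have "f ([n] \<cdot>\<^bsub>M\<^esub> x) = [n] \<cdot>\<^bsub>N\<^esub> f x" for n :: nat
    by (induction n) (use x in simp_all)
  then show ?thesis
    using x by (cases k) (simp_all add: add_pow_int_ge add_pow_int_lt)
qed

lemma module_hom_pointwise_add:
  assumes "module R M" and "module R N" and f: "f \<in> module_hom R M N" and g: "g \<in> module_hom R M N"
  shows "(\<lambda>x. f x \<oplus>\<^bsub>N\<^esub> g x) \<in> module_hom R M N"
proof -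
  interpret N: module R N by fact
  note closed = module_hom_closedD[OF f] module_hom_closedD[OF g]
  show ?thesis
  proof (rule module_homI)
    fix x y assume "x \<in> carrier M" "y \<in> carrier M"
    then show "f (x \<oplus>\<^bsub>M\<^esub> y) \<oplus>\<^bsub>N\<^esub> g (x \<oplus>\<^bsub>M\<^esub> y) = f x \<oplus>\<^bsub>N\<^esub> g x \<oplus>\<^bsub>N\<^esub> (f y \<oplus>\<^bsub>N\<^esub> g y)"
      by (simp add: module_hom_add[OF f] module_hom_add[OF g] closed N.M.a_ac)
  next
    fix r x assume "r \<in> carrier R" "x \<in> carrier M"
    then show "f (r \<odot>\<^bsub>M\<^esub> x) \<oplus>\<^bsub>N\<^esub> g (r \<odot>\<^bsub>M\<^esub> x) = r \<odot>\<^bsub>N\<^esub> (f x \<oplus>\<^bsub>N\<^esub> g x)"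
      by (simp add: module_hom_smult[OF f] module_hom_smult[OF g] closed N.smult_r_distr)
  qed (simp add: closed)
qed

lemma module_hom_pointwise_smult:
  assumes "module R N" and f: "f \<in> module_hom R M N" and r: "r \<in> carrier R"
  shows "(\<lambda>x. r \<odot>\<^bsub>N\<^esub> f x) \<in> module_hom R M N"
proof -
  interpret N: module R N by fact
  note closed = module_hom_closedD[OF f]
  show ?thesis
  proof (rule module_homI)
    fix s x assume "s \<in> carrier R" "x \<in> carrier M"
    then show "r \<odot>\<^bsub>N\<^esub> f (s \<odot>\<^bsub>M\<^esub> x) = s \<odot>\<^bsub>N\<^esub> (r \<odot>\<^bsub>N\<^esub> f x)"
      using r by (simp add: module_hom_smult[OF f] closed N.R.m_comm flip: N.smult_assoc1)
  qed (use r in \<open>simp_all add: module_hom_add[OF f] closed N.smult_r_distr\<close>)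
qed

lemma module_hom_pointwise_diff:
  assumes M: "module R M" and N: "module R N" and f: "f \<in> module_hom R M N" and g: "g \<in> module_hom R M N"
  shows "(\<lambda>x. f x \<ominus>\<^bsub>N\<^esub> g x) \<in> module_hom R M N"
proof -
  interpret N: module R N by (rule N)
  have eq: "f x \<ominus>\<^bsub>N\<^esub> g x = f x \<oplus>\<^bsub>N\<^esub> (\<ominus>\<^bsub>R\<^esub> \<one>\<^bsub>R\<^esub>) \<odot>\<^bsub>N\<^esub> g x" if "x \<in> carrier M" for x
    unfolding a_minus_def N.smult_minus_1[OF module_hom_closedD[OF g that]] ..
  have "(\<lambda>x. f x \<oplus>\<^bsub>N\<^esub> (\<ominus>\<^bsub>R\<^esub> \<one>\<^bsub>R\<^esub>) \<odot>\<^bsub>N\<^esub> g x) \<in> module_hom R M N"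
    by (rule module_hom_pointwise_add[OF M N f module_hom_pointwise_smult[OF N g]]) simp
  then show ?thesis
    by (rule module_hom_cong[OF M, THEN iffD2, rotated]) (rule eq)
qed

lemma int_multiple_closed:
  fixes k :: int
  assumes "module R M" and "x \<in> carrier M"
  shows "[k] \<cdot>\<^bsub>M\<^esub> x \<in> carrier M"
proof -
  interpret module R M by fact
  show ?thesis using M.add.int_pow_closed[OF assms(2)] .
qed

text \<open>Each law follows by applying the left inverse to the image under \<open>h\<close> of the
  wanted right-hand side. It is what makes the comultiplication linear.\<close>

lemma inv_into_module_hom:
  assumes M: "module R M" and h: "h \<in> module_hom R M N" and bij: "bij_betw h (carrier M) (carrier N)"
  shows "inv_into (carrier M) h \<in> module_hom R N M"
proof -
  interpret M: module R M by (rule M)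
  let ?g = "inv_into (carrier M) h"
  have g: "?g y \<in> carrier M" "h (?g y) = y" if "y \<in> carrier N" for y
    using that bij_betwE[OF bij_betw_inv_into[OF bij]] bij_betw_inv_into_right[OF bij] by auto
  have left: "?g (h x) = x" if "x \<in> carrier M" for x
    using bij_betw_inv_into_left[OF bij that] .
  show ?thesis
  proof (rule module_homI)
    fix y z assume y: "y \<in> carrier N" and z: "z \<in> carrier N"
    show "?g (y \<oplus>\<^bsub>N\<^esub> z) = ?g y \<oplus>\<^bsub>M\<^esub> ?g z"
      using left[OF M.M.a_closed[OF g(1)[OF y] g(1)[OF z]]]
      unfolding module_hom_add[OF h g(1)[OF y] g(1)[OF z]] g(2)[OF y] g(2)[OF z] .
  next
    fix r y assume r: "r \<in> carrier R" and y: "y \<in> carrier N"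
    show "?g (r \<odot>\<^bsub>N\<^esub> y) = r \<odot>\<^bsub>M\<^esub> ?g y"
      using left[OF M.smult_closed[OF r g(1)[OF y]]]
      unfolding module_hom_smult[OF h r g(1)[OF y]] g(2)[OF y] .
  qed (rule g(1))
qed

text \<open>Lets an expansion such as \<open>contract_expansion\<close> count as a linear map of its
  tensor, so that it can be checked on pure tensors.\<close>

lemma module_hom_finsum_maps:
  assumes "module R M" and "module R N" and f: "\<And>a. a \<in> A \<Longrightarrow> f a \<in> module_hom R M N"
  shows "(\<lambda>x. \<Oplus>\<^bsub>N\<^esub>a\<in>A. f a x) \<in> module_hom R M N"
proof -
  interpret M: module R M by fact
  interpret N: module R N by fact
  have closed: "a \<in> A \<Longrightarrow> x \<in> carrier M \<Longrightarrow> f a x \<in> carrier N" for a x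
    using f by (blast dest: module_hom_closedD)
  show ?thesis
  proof (rule module_homI)
    fix x y assume x: "x \<in> carrier M" and y: "y \<in> carrier M"
    have "(\<Oplus>\<^bsub>N\<^esub>a\<in>A. f a (x \<oplus>\<^bsub>M\<^esub> y)) = (\<Oplus>\<^bsub>N\<^esub>a\<in>A. f a x \<oplus>\<^bsub>N\<^esub> f a y)"
      using x y f closed by (intro N.finsum_cong') (auto simp: module_hom_add[OF f])
    then show "(\<Oplus>\<^bsub>N\<^esub>a\<in>A. f a (x \<oplus>\<^bsub>M\<^esub> y)) = (\<Oplus>\<^bsub>N\<^esub>a\<in>A. f a x) \<oplus>\<^bsub>N\<^esub> (\<Oplus>\<^bsub>N\<^esub>a\<in>A. f a y)"
      using x y closed by (simp add: N.finsum_addf Pi_iff)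
  next
    fix r x assume r: "r \<in> carrier R" and x: "x \<in> carrier M"
    have "(\<Oplus>\<^bsub>N\<^esub>a\<in>A. f a (r \<odot>\<^bsub>M\<^esub> x)) = (\<Oplus>\<^bsub>N\<^esub>a\<in>A. r \<odot>\<^bsub>N\<^esub> f a x)"
      using r x f closed by (intro N.finsum_cong') (auto simp: module_hom_smult[OF f])
    then show "(\<Oplus>\<^bsub>N\<^esub>a\<in>A. f a (r \<odot>\<^bsub>M\<^esub> x)) = r \<odot>\<^bsub>N\<^esub> (\<Oplus>\<^bsub>N\<^esub>a\<in>A. f a x)"
      using r x closed by (simp add: N.finsum_smult Pi_iff)
  qed (use closed in \<open>auto intro!: N.finsum_closed\<close>)
qed

section \<open>The base ring as a module, the target of linear forms\<close>

lemma regular_module_simps [simp]: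
  "carrier (regular_module R) = carrier R"
  "\<zero>\<^bsub>regular_module R\<^esub> = \<zero>\<^bsub>R\<^esub>"
  "x \<oplus>\<^bsub>regular_module R\<^esub> y = x \<oplus>\<^bsub>R\<^esub> y"
  "r \<odot>\<^bsub>regular_module R\<^esub> x = r \<otimes>\<^bsub>R\<^esub> x"
  by (simp_all add: regular_module_def)

lemma regular_module_module:
  assumes "cring R"
  shows "module R (regular_module R)"
proof -
  interpret cring R by fact
  show ?thesis
    by (rule module_criteria)
      (auto simp: assms a_assoc m_assoc l_distr r_distr intro: a_comm bexI[of _ "\<ominus>\<^bsub>R\<^esub> _"] r_neg)
qed

text \<open>These maps of rank one are the partial maps of the contraction and of the product of two
  forms.\<close>

lemma module_hom_smult_const:
  assumes "module R N" and h: "h \<in> module_hom R A (regular_module R)" and n: "n \<in> carrier N"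
  shows "(\<lambda>a. h a \<odot>\<^bsub>N\<^esub> n) \<in> module_hom R A N"
proof -
  interpret N: module R N by fact
  have "h a \<in> carrier R" if "a \<in> carrier A" for a
    using module_hom_closedD[OF h that] by simp
  then show ?thesis
    using n by (intro module_homI)
      (simp_all add: module_hom_add[OF h] module_hom_smult[OF h] N.smult_l_distr N.smult_assoc1)
qed


section \<open>Free modules and quotient modules\<close>

lemma free_module_simps [simp]:
  "\<zero>\<^bsub>free_module R S\<^esub> = (\<lambda>x. \<zero>\<^bsub>R\<^esub>)"
  "f \<oplus>\<^bsub>free_module R S\<^esub> g = (\<lambda>x. f x \<oplus>\<^bsub>R\<^esub> g x)"
  "r \<odot>\<^bsub>free_module R S\<^esub> f = (\<lambda>x. r \<otimes>\<^bsub>R\<^esub> f x)"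
  by (simp_all add: free_module_def)

lemma free_module_carrier_iff:
  assumes "cring R"
  shows "f \<in> carrier (free_module R S) \<longleftrightarrow>
    range f \<subseteq> carrier R \<and> {x. f x \<noteq> \<zero>\<^bsub>R\<^esub>} \<subseteq> S \<and> finite {x. f x \<noteq> \<zero>\<^bsub>R\<^esub>}"
proof -
  interpret cring R by fact
  show ?thesis by (auto simp: free_module_def Pi_iff)
qed

lemma free_module_module:
  assumes "cring R"
  shows "module R (free_module R S)"
proof -
  interpret cring R by fact
  note iff = free_module_carrier_iff[OF assms]
  have R: "f \<in> carrier (free_module R S) \<Longrightarrow> f x \<in> carrier R" for f x
    by (auto simp: iff)
  \<comment> \<open>One closure argument for all pointwise operations: if \<open>h\<close> preserves
    zero, the support of the result lies in the union of the two supports. The unary cases, scalar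
    multiple and negative, ignore the second argument.\<close>
  have closed: "(\<lambda>x. h (f x) (g x)) \<in> carrier (free_module R S)"
    if "f \<in> carrier (free_module R S)" and "g \<in> carrier (free_module R S)"
      and "\<And>a b. a \<in> carrier R \<Longrightarrow> b \<in> carrier R \<Longrightarrow> h a b \<in> carrier R" and "h \<zero>\<^bsub>R\<^esub> \<zero>\<^bsub>R\<^esub> = \<zero>\<^bsub>R\<^esub>" for f g h
  proof -
    have "{x. h (f x) (g x) \<noteq> \<zero>\<^bsub>R\<^esub>} \<subseteq> {x. f x \<noteq> \<zero>\<^bsub>R\<^esub>} \<union> {x. g x \<noteq> \<zero>\<^bsub>R\<^esub>}"
      using that(4) by auto
    with that show ?thesis
      by (auto simp: iff image_subset_iff intro: finite_subset dest: subsetD)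
  qed
  have smult: "(\<lambda>x. c \<otimes>\<^bsub>R\<^esub> f x) \<in> carrier (free_module R S)"
    if "c \<in> carrier R" and "f \<in> carrier (free_module R S)" for c f
    using closed[OF that(2,2), of "\<lambda>a b. c \<otimes>\<^bsub>R\<^esub> a"] that(1) by simp
  show ?thesis
  proof (rule module_criteria)
    show "\<forall>f\<in>carrier (free_module R S). \<exists>g\<in>carrier (free_module R S).
        f \<oplus>\<^bsub>free_module R S\<^esub> g = \<zero>\<^bsub>free_module R S\<^esub>"
    proof
      fix f assume f: "f \<in> carrier (free_module R S)"
      show "\<exists>g\<in>carrier (free_module R S). f \<oplus>\<^bsub>free_module R S\<^esub> g = \<zero>\<^bsub>free_module R S\<^esub>"
        using closed[OF f f, of "\<lambda>a b. \<ominus>\<^bsub>R\<^esub> a"] R[OF f] by (intro bexI[of _ "\<lambda>x. \<ominus>\<^bsub>R\<^esub> f x"]) (auto simp: r_neg)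
    qed
    show "\<forall>c v. c \<in> carrier R \<and> v \<in> carrier (free_module R S) \<longrightarrow>
        c \<odot>\<^bsub>free_module R S\<^esub> v \<in> carrier (free_module R S)"
      using smult by simp
    show "\<forall>v w. v \<in> carrier (free_module R S) \<and> w \<in> carrier (free_module R S) \<longrightarrow>
        v \<oplus>\<^bsub>free_module R S\<^esub> w \<in> carrier (free_module R S)"
      using closed[of _ _ "(\<oplus>\<^bsub>R\<^esub>)"] by simp
    show "\<forall>u v w. u \<in> carrier (free_module R S) \<and> v \<in> carrier (free_module R S) \<and> w \<in> carrier (free_module R S) \<longrightarrow>
        u \<oplus>\<^bsub>free_module R S\<^esub> v \<oplus>\<^bsub>free_module R S\<^esub> w = u \<oplus>\<^bsub>free_module R S\<^esub> (v \<oplus>\<^bsub>free_module R S\<^esub> w)"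
      by (simp add: R a_assoc)
    show "\<forall>v w. v \<in> carrier (free_module R S) \<and> w \<in> carrier (free_module R S) \<longrightarrow>
        v \<oplus>\<^bsub>free_module R S\<^esub> w = w \<oplus>\<^bsub>free_module R S\<^esub> v"
      by (simp add: R a_comm)
    show "\<zero>\<^bsub>free_module R S\<^esub> \<in> carrier (free_module R S)"
      by (auto simp: iff)
  qed (auto simp: assms R m_assoc l_distr r_distr)
qed

lemma free_gen_closed:
  assumes "cring R" and "p \<in> S"
  shows "free_gen R p \<in> carrier (free_module R S)"
proof -
  interpret cring R by fact
  show ?thesis using assms(2) by (auto simp: free_module_carrier_iff[OF assms(1)] free_gen_def)
qed

text \<open>A function of finite support is a finite combination of generators; the coordinates are
  removed one at a time.\<close>

lemma free_module_hom_eqI: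
  assumes "module R P" and h: "h \<in> module_hom R (free_module R S) P"
    and k: "k \<in> module_hom R (free_module R S) P"
    and eq: "\<And>p. p \<in> S \<Longrightarrow> h (free_gen R p) = k (free_gen R p)"
    and f: "f \<in> carrier (free_module R S)"
  shows "h f = k f"
proof -
  interpret P: module R P by fact
  have R: "cring R" ..
  interpret F: module R "free_module R S" by (rule free_module_module) (rule R)
  note iff = free_module_carrier_iff[OF R]
  \<comment> \<open>The induction runs over a finite set that bounds the support, not over the
    support itself, so the removed point may already be a zero of \<open>f\<close>.\<close>
  have "h f = k f" if "finite T" and "{x. f x \<noteq> \<zero>\<^bsub>R\<^esub>} \<subseteq> T"
      and "f \<in> carrier (free_module R S)" for T f
    using that
  proof (induction T arbitrary: f)
    case empty
    then have "f = \<zero>\<^bsub>free_module R S\<^esub>" by auto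
    then show ?case
      using module_hom_zero[OF F.module_axioms P.module_axioms] h k by metis
  next
    case (insert p T)
    show ?case
    proof (cases "f p = \<zero>\<^bsub>R\<^esub>")
      case True
      with insert.prems have "{x. f x \<noteq> \<zero>\<^bsub>R\<^esub>} \<subseteq> T" by auto
      with insert show ?thesis by simp
    next
      case False
      \<comment> \<open>Deleting the coordinate at \<open>p\<close> brings the support into
        \<open>T\<close>; what is lost is the multiple \<open>f p\<close> of the generator at
        \<open>p\<close>.\<close>
      define g where "g = f(p := \<zero>\<^bsub>R\<^esub>)"
      have p: "p \<in> S" and fp: "f p \<in> carrier R"
        using False insert.prems(2) by (auto simp: iff)
      have "{x. g x \<noteq> \<zero>\<^bsub>R\<^esub>} \<subseteq> {x. f x \<noteq> \<zero>\<^bsub>R\<^esub>}"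
        by (auto simp: g_def)
      moreover have "range g \<subseteq> carrier R"
        using insert.prems(2) by (auto simp: g_def iff)
      ultimately have g: "g \<in> carrier (free_module R S)"
        using insert.prems(2) unfolding iff by (meson finite_subset subset_trans)
      have "h g = k g"
        using insert.prems(1) by (intro insert.IH[OF _ g]) (auto simp: g_def)
      have gen: "free_gen R p \<in> carrier (free_module R S)"
        using free_gen_closed[OF R p] .
      have f_eq: "f = g \<oplus>\<^bsub>free_module R S\<^esub> f p \<odot>\<^bsub>free_module R S\<^esub> free_gen R p"
        using insert.prems(2) by (auto simp: g_def free_gen_def iff fun_eq_iff image_subset_iff)
      have split: "u f = u g \<oplus>\<^bsub>P\<^esub> f p \<odot>\<^bsub>P\<^esub> u (free_gen R p)"
        if "u \<in> module_hom R (free_module R S) P" for u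
        by (subst f_eq)
          (simp only: module_hom_add[OF that g F.smult_closed[OF fp gen]] module_hom_smult[OF that fp gen])
      show ?thesis
        using split[OF h] split[OF k] \<open>h g = k g\<close> eq[OF p] by simp
    qed
  qed
  then show ?thesis using f by (auto simp: iff)
qed

lemma free_module_lift:
  assumes "module R P" and b: "\<And>p. p \<in> S \<Longrightarrow> b p \<in> carrier P"
  obtains h where "h \<in> module_hom R (free_module R S) P"
    and "\<And>p. p \<in> S \<Longrightarrow> h (free_gen R p) = b p"
proof -
  interpret P: module R P by fact
  have R: "cring R" ..
  interpret F: module R "free_module R S" by (rule free_module_module) (rule R)
  note iff = free_module_carrier_iff[OF R]
  define h where "h f = (\<Oplus>\<^bsub>P\<^esub>p\<in>{p. f p \<noteq> \<zero>\<^bsub>R\<^esub>}. f p \<odot>\<^bsub>P\<^esub> b p)" for f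
  have summand: "f p \<odot>\<^bsub>P\<^esub> b p \<in> carrier P" if "f \<in> carrier (free_module R S)" "p \<in> S" for f p
    using that b by (auto simp: iff image_subset_iff)
  \<comment> \<open>The supports of \<open>f\<close>, \<open>g\<close> and their sum differ, so the
    defining sum is first extended by zeros to any finite set above the support. That set must stay
    inside \<open>S\<close>, where \<open>b\<close> is known to take values in
    \<open>P\<close>.\<close>
  have h: "h f = (\<Oplus>\<^bsub>P\<^esub>p\<in>T. f p \<odot>\<^bsub>P\<^esub> b p)"
    if "f \<in> carrier (free_module R S)" "finite T" "{p. f p \<noteq> \<zero>\<^bsub>R\<^esub>} \<subseteq> T" "T \<subseteq> S" for f T
    unfolding h_def using that b
    by (intro P.add.finprod_mono_neutral_cong_left) (auto simp: summand iff)
  show ?thesis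
  proof
    show "h \<in> module_hom R (free_module R S) P"
    proof (rule module_homI)
      fix f assume f: "f \<in> carrier (free_module R S)"
      then show "h f \<in> carrier P"
        unfolding h_def by (auto intro!: P.finsum_closed summand simp: iff)
    next
      fix f g assume f: "f \<in> carrier (free_module R S)" and g: "g \<in> carrier (free_module R S)"
      define T where "T = {p. f p \<noteq> \<zero>\<^bsub>R\<^esub>} \<union> {p. g p \<noteq> \<zero>\<^bsub>R\<^esub>}"
      have T: "finite T" "T \<subseteq> S" using f g by (auto simp: T_def iff)
      have supp: "{p. f p \<oplus>\<^bsub>R\<^esub> g p \<noteq> \<zero>\<^bsub>R\<^esub>} \<subseteq> T" by (auto simp: T_def)
      have "h (f \<oplus>\<^bsub>free_module R S\<^esub> g) = (\<Oplus>\<^bsub>P\<^esub>p\<in>T. (f p \<oplus>\<^bsub>R\<^esub> g p) \<odot>\<^bsub>P\<^esub> b p)"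
        using h[OF F.M.a_closed[OF f g] T(1) _ T(2)] supp by simp
      also have "\<dots> = (\<Oplus>\<^bsub>P\<^esub>p\<in>T. f p \<odot>\<^bsub>P\<^esub> b p \<oplus>\<^bsub>P\<^esub> g p \<odot>\<^bsub>P\<^esub> b p)"
        using f g T summand b by (intro P.finsum_cong') (auto simp: iff intro!: P.smult_l_distr)
      also have "\<dots> = (\<Oplus>\<^bsub>P\<^esub>p\<in>T. f p \<odot>\<^bsub>P\<^esub> b p) \<oplus>\<^bsub>P\<^esub> (\<Oplus>\<^bsub>P\<^esub>p\<in>T. g p \<odot>\<^bsub>P\<^esub> b p)"
        using f g T summand by (intro P.finsum_addf) auto
      also have "\<dots> = h f \<oplus>\<^bsub>P\<^esub> h g"
        using h[OF f T(1) _ T(2)] h[OF g T(1) _ T(2)] by (auto simp: T_def)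
      finally show "h (f \<oplus>\<^bsub>free_module R S\<^esub> g) = h f \<oplus>\<^bsub>P\<^esub> h g" .
    next
      fix r f assume r: "r \<in> carrier R" and f: "f \<in> carrier (free_module R S)"
      define T where "T = {p. f p \<noteq> \<zero>\<^bsub>R\<^esub>}"
      have T: "finite T" "T \<subseteq> S" using f by (auto simp: T_def iff)
      have supp: "{p. r \<otimes>\<^bsub>R\<^esub> f p \<noteq> \<zero>\<^bsub>R\<^esub>} \<subseteq> T" using r by (auto simp: T_def)
      have "h (r \<odot>\<^bsub>free_module R S\<^esub> f) = (\<Oplus>\<^bsub>P\<^esub>p\<in>T. (r \<otimes>\<^bsub>R\<^esub> f p) \<odot>\<^bsub>P\<^esub> b p)"
        using h[OF F.smult_closed[OF r f] T(1) _ T(2)] supp by simp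
      also have "\<dots> = (\<Oplus>\<^bsub>P\<^esub>p\<in>T. r \<odot>\<^bsub>P\<^esub> (f p \<odot>\<^bsub>P\<^esub> b p))"
        using r f T summand b by (intro P.finsum_cong') (auto simp: iff intro!: P.smult_assoc1)
      also have "\<dots> = r \<odot>\<^bsub>P\<^esub> (\<Oplus>\<^bsub>P\<^esub>p\<in>T. f p \<odot>\<^bsub>P\<^esub> b p)"
        using r f T summand by (intro P.finsum_smult[symmetric]) auto
      also have "\<dots> = r \<odot>\<^bsub>P\<^esub> h f"
        using h[OF f T(1) _ T(2)] by (auto simp: T_def)
      finally show "h (r \<odot>\<^bsub>free_module R S\<^esub> f) = r \<odot>\<^bsub>P\<^esub> h f" .
    qed
  next
    fix p assume p: "p \<in> S"
    have "h (free_gen R p) = (\<Oplus>\<^bsub>P\<^esub>q\<in>{p}. free_gen R p q \<odot>\<^bsub>P\<^esub> b q)"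
      using p by (intro h free_gen_closed[OF R p]) (auto simp: free_gen_def)
    then show "h (free_gen R p) = b p"
      using b[OF p] by (simp add: free_gen_def)
  qed
qed

(* With these rules simp would replace the operations of the free module by abstractions, to which
   the lemmas on quotients do not apply. *)
declare free_module_simps [simp del]

section \<open>Quotients by submodules\<close>

locale module_quotient = module R F for R and F (structure) +
  fixes K
  assumes submodule: "LinearCombinations.submodule R K F"
begin

text \<open>A submodule is closed under negation because negation is multiplication by the scalar
  -1. This opens the coset arithmetic of abelian groups.\<close>

sublocale abelian_subgroup K F
proof (rule abelian_subgroupI3)
  interpret K: LinearCombinations.submodule R K F by (rule submodule)
  have "\<ominus>\<^bsub>F\<^esub> x \<in> K" if "x \<in> K" for x
    using that K.subset K.smult_closed[OF R.a_inv_closed[OF R.one_closed] that]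
    by (metis smult_minus_1 subsetD)
  then show "additive_subgroup K F"
    using K.subset K.zero_closed K.m_closed
    by (auto simp: additive_subgroup_def subgroup_def a_inv_def)
qed (rule M.abelian_group_axioms)

lemma coset_in_carrier [simp]:
  "x \<in> carrier F \<Longrightarrow> K +>\<^bsub>F\<^esub> x \<in> carrier (quotient_module F K)"
  using a_rcosetsI a_subset by (auto simp: quotient_module_def)

lemma carrier_cosetE:
  assumes "X \<in> carrier (quotient_module F K)"
  obtains x where "x \<in> carrier F" and "X = K +>\<^bsub>F\<^esub> x"
  using assms by (auto simp: quotient_module_def A_RCOSETS_def')

lemma coset_add:
  "x \<in> carrier F \<Longrightarrow> y \<in> carrier F \<Longrightarrow>
    (K +>\<^bsub>F\<^esub> x) \<oplus>\<^bsub>quotient_module F K\<^esub> (K +>\<^bsub>F\<^esub> y) = K +>\<^bsub>F\<^esub> (x \<oplus>\<^bsub>F\<^esub> y)"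
  by (simp add: quotient_module_def a_rcos_sum)

lemma coset_zero: "\<zero>\<^bsub>quotient_module F K\<^esub> = K"
  by (simp add: quotient_module_def)

lemma coset_of_mem: "x \<in> K \<Longrightarrow> K +>\<^bsub>F\<^esub> x = K"
  using a_coset_join2 a_Hcarr a_subgroup by blast

lemma coset_eqD:
  assumes "K +>\<^bsub>F\<^esub> x = K +>\<^bsub>F\<^esub> y" and "x \<in> carrier F" and "y \<in> carrier F"
  shows "x \<ominus>\<^bsub>F\<^esub> y \<in> K"
  using a_rcos_module[OF assms(3,2)] a_rcos_self[OF assms(2)] assms(1)
  by (simp add: a_minus_def)

text \<open>The scalar multiple of a coset is a union over all its representatives. Changing the
  representative by \<open>k\<close> changes the result by \<open>r\<close> times \<open>k\<close>,
  which lies in \<open>K\<close>, so this is the union of a constant nonempty family.\<close>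

lemma coset_smult:
  assumes r: "r \<in> carrier R" and x: "x \<in> carrier F"
  shows "r \<odot>\<^bsub>quotient_module F K\<^esub> (K +>\<^bsub>F\<^esub> x) = K +>\<^bsub>F\<^esub> (r \<odot>\<^bsub>F\<^esub> x)"
proof -
  interpret K: LinearCombinations.submodule R K F by (rule submodule)
  have "K +>\<^bsub>F\<^esub> (r \<odot>\<^bsub>F\<^esub> (k \<oplus>\<^bsub>F\<^esub> x)) = K +>\<^bsub>F\<^esub> (r \<odot>\<^bsub>F\<^esub> x)" if "k \<in> K" for k
  proof -
    have k: "k \<in> carrier F" "r \<odot>\<^bsub>F\<^esub> k \<in> K" using that r by auto
    have "K +>\<^bsub>F\<^esub> (r \<odot>\<^bsub>F\<^esub> (k \<oplus>\<^bsub>F\<^esub> x)) = (K +>\<^bsub>F\<^esub> (r \<odot>\<^bsub>F\<^esub> k)) +>\<^bsub>F\<^esub> (r \<odot>\<^bsub>F\<^esub> x)"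
      using k r x a_subset by (simp add: smult_r_distr M.a_coset_add_assoc)
    with k show ?thesis by (simp add: coset_of_mem)
  qed
  moreover have "K +>\<^bsub>F\<^esub> x = (\<lambda>k. k \<oplus>\<^bsub>F\<^esub> x) ` K"
    by (auto simp: a_r_coset_def')
  moreover have "K \<noteq> {}" using K.zero_closed by blast
  ultimately show ?thesis by (simp add: quotient_module_def)
qed

lemma quotient_module_module: "module R (quotient_module F K)"
proof -
  let ?Q = "quotient_module F K"
  have zero: "\<zero>\<^bsub>quotient_module F K\<^esub> = K +>\<^bsub>F\<^esub> \<zero>\<^bsub>F\<^esub>"
    by (simp add: coset_zero coset_of_mem)
  show ?thesis
  proof (rule module_criteria)
    show "cring R" ..
    show "\<zero>\<^bsub>quotient_module F K\<^esub> \<in> carrier (quotient_module F K)"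
      by (simp add: zero)
    show "\<forall>v\<in>carrier (quotient_module F K). \<exists>w\<in>carrier (quotient_module F K).
        v \<oplus>\<^bsub>quotient_module F K\<^esub> w = \<zero>\<^bsub>quotient_module F K\<^esub>"
    proof
      fix v assume "v \<in> carrier (quotient_module F K)"
      then obtain x where "x \<in> carrier F" "v = K +>\<^bsub>F\<^esub> x" by (rule carrier_cosetE)
      then show "\<exists>w\<in>carrier (quotient_module F K). v \<oplus>\<^bsub>quotient_module F K\<^esub> w = \<zero>\<^bsub>quotient_module F K\<^esub>"
        by (intro bexI[of _ "K +>\<^bsub>F\<^esub> (\<ominus>\<^bsub>F\<^esub> x)"]) (auto simp: coset_add zero M.r_neg)
    qed
    show "\<forall>u v w. u \<in> carrier ?Q \<and> v \<in> carrier ?Q \<and> w \<in> carrier ?Q \<longrightarrow>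
        u \<oplus>\<^bsub>?Q\<^esub> v \<oplus>\<^bsub>?Q\<^esub> w = u \<oplus>\<^bsub>?Q\<^esub> (v \<oplus>\<^bsub>?Q\<^esub> w)"
      by (auto elim!: carrier_cosetE simp: coset_add M.a_assoc)
    show "\<forall>v w. v \<in> carrier ?Q \<and> w \<in> carrier ?Q \<longrightarrow> v \<oplus>\<^bsub>?Q\<^esub> w = w \<oplus>\<^bsub>?Q\<^esub> v"
      using M.a_comm by (auto elim!: carrier_cosetE simp: coset_add)
  qed (auto elim!: carrier_cosetE simp: coset_add coset_smult zero
      smult_assoc1 smult_l_distr smult_r_distr)
qed

lemma coset_hom: "(\<lambda>x. K +>\<^bsub>F\<^esub> x) \<in> module_hom R F (quotient_module F K)"
  by (auto intro!: module_homI simp: coset_add coset_smult)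

lemma coset_eqI:
  assumes "x \<in> carrier F" and "y \<in> carrier F" and "x \<ominus>\<^bsub>F\<^esub> y \<in> K"
  shows "K +>\<^bsub>F\<^esub> x = K +>\<^bsub>F\<^esub> y"
proof -
  interpret Q: module R "quotient_module F K" by (rule quotient_module_module)
  have "(K +>\<^bsub>F\<^esub> x) \<ominus>\<^bsub>quotient_module F K\<^esub> (K +>\<^bsub>F\<^esub> y) = \<zero>\<^bsub>quotient_module F K\<^esub>"
    using module_hom_diff[OF module_axioms Q.module_axioms coset_hom assms(1,2)] assms(3)
    by (simp add: coset_of_mem coset_zero)
  then show ?thesis using assms by simp
qed

lemma quotient_module_lift:
  assumes "module R P" and h: "h \<in> module_hom R F P" and K: "\<And>k. k \<in> K \<Longrightarrow> h k = \<zero>\<^bsub>P\<^esub>"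
  obtains g where "g \<in> module_hom R (quotient_module F K) P"
    and "\<And>x. x \<in> carrier F \<Longrightarrow> g (K +>\<^bsub>F\<^esub> x) = h x"
proof
  interpret P: module R P by fact
  \<comment> \<open>The value is read off at a chosen representative. Two representatives differ by
    an element of \<open>K\<close>, which \<open>h\<close> sends to zero.\<close>
  define g where "g X = h (SOME x. x \<in> carrier F \<and> X = K +>\<^bsub>F\<^esub> x)" for X
  show g: "g (K +>\<^bsub>F\<^esub> x) = h x" if x: "x \<in> carrier F" for x
  proof -
    define y where "y = (SOME y. y \<in> carrier F \<and> K +>\<^bsub>F\<^esub> x = K +>\<^bsub>F\<^esub> y)"
    have y: "y \<in> carrier F \<and> K +>\<^bsub>F\<^esub> x = K +>\<^bsub>F\<^esub> y"
      unfolding y_def by (rule someI[of _ x]) (simp add: x)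
    then have "h (x \<ominus>\<^bsub>F\<^esub> y) = \<zero>\<^bsub>P\<^esub>"
      using K coset_eqD x by blast
    then have "h x \<ominus>\<^bsub>P\<^esub> h y = \<zero>\<^bsub>P\<^esub>"
      using module_hom_diff[OF module_axioms P.module_axioms h] x y by simp
    then have "h x = h y"
      using module_hom_closedD[OF h] x y by simp
    then show ?thesis by (simp add: g_def y_def)
  qed
  show "g \<in> module_hom R (quotient_module F K) P"
    using module_hom_closedD[OF h] module_hom_add[OF h] module_hom_smult[OF h]
    by (intro module_homI) (auto elim!: carrier_cosetE simp: g coset_add coset_smult)
qed

end


section \<open>Tensor products\<close>

definition bilinear_map ::
    "('a, 'k) ring_scheme \<Rightarrow> ('a, 'b, 'm) module_scheme \<Rightarrow> ('a, 'c, 'n) module_scheme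
      \<Rightarrow> ('a, 'd, 'p) module_scheme \<Rightarrow> ('b \<Rightarrow> 'c \<Rightarrow> 'd) \<Rightarrow> bool"
  where "bilinear_map R M N P b \<longleftrightarrow>
    (\<forall>x\<in>carrier M. b x \<in> module_hom R N P) \<and> (\<forall>y\<in>carrier N. (\<lambda>x. b x y) \<in> module_hom R M P)"

lemma bilinear_mapD:
  assumes "bilinear_map R M N P b"
  shows "x \<in> carrier M \<Longrightarrow> b x \<in> module_hom R N P"
    and "y \<in> carrier N \<Longrightarrow> (\<lambda>x. b x y) \<in> module_hom R M P"
  using assms by (simp_all add: bilinear_map_def)

context
  fixes R :: "('a, 'k) ring_scheme"
    and M :: "('a, 'b, 'm) module_scheme" and N :: "('a, 'c, 'n) module_scheme"
  assumes M: "module R M" and N: "module R N"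
begin

private abbreviation (input) "F \<equiv> free_module R (carrier M \<times> carrier N)"
private abbreviation (input) "e x y \<equiv> free_gen R (x, y)"

interpretation M: module R M by (rule M)
interpretation N: module R N by (rule N)

interpretation F: module R F
  by (rule free_module_module) (rule M.R.is_cring)

lemma bilinear_relations_cases:
  assumes "u \<in> bilinear_relations R M N"
  obtains x x' y where "x \<in> carrier M" "x' \<in> carrier M" "y \<in> carrier N"
      "u = e (x \<oplus>\<^bsub>M\<^esub> x') y \<ominus>\<^bsub>F\<^esub> (e x y \<oplus>\<^bsub>F\<^esub> e x' y)"
    | x y y' where "x \<in> carrier M" "y \<in> carrier N" "y' \<in> carrier N"
      "u = e x (y \<oplus>\<^bsub>N\<^esub> y') \<ominus>\<^bsub>F\<^esub> (e x y \<oplus>\<^bsub>F\<^esub> e x y')"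
    | r x y where "r \<in> carrier R" "x \<in> carrier M" "y \<in> carrier N"
      "u = e (r \<odot>\<^bsub>M\<^esub> x) y \<ominus>\<^bsub>F\<^esub> r \<odot>\<^bsub>F\<^esub> e x y"
    | r x y where "r \<in> carrier R" "x \<in> carrier M" "y \<in> carrier N"
      "u = e x (r \<odot>\<^bsub>N\<^esub> y) \<ominus>\<^bsub>F\<^esub> r \<odot>\<^bsub>F\<^esub> e x y"
  using assms unfolding bilinear_relations_def Let_def
  by (elim UnE CollectE exE conjE) (rule that, assumption+)+

lemma gen_closed: "x \<in> carrier M \<Longrightarrow> y \<in> carrier N \<Longrightarrow> e x y \<in> carrier F"
  by (rule free_gen_closed) (auto intro: M.R.is_cring)

lemma bilinear_relations_closed: "bilinear_relations R M N \<subseteq> carrier F"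
proof
  fix u assume "u \<in> bilinear_relations R M N"
  then show "u \<in> carrier F"
    by (cases rule: bilinear_relations_cases) (simp_all add: gen_closed)
qed

lemma tensor_module_quotient: "module_quotient R F (bilinear_submodule R M N)"
  unfolding bilinear_submodule_def
  by (rule module_quotient.intro[OF F.module_axioms module_quotient_axioms.intro[OF
    F.span_is_submodule[OF bilinear_relations_closed]]])

interpretation module_quotient R F "bilinear_submodule R M N"
  by (rule tensor_module_quotient)

lemma tensor_product_module: "module R (tensor_product R M N)"
  unfolding tensor_product_def by (rule quotient_module_module)

interpretation T: module R "tensor_product R M N"
  by (rule tensor_product_module)

lemma relations_subset: "u \<in> bilinear_relations R M N \<Longrightarrow> u \<in> bilinear_submodule R M N"
  unfolding bilinear_submodule_def using F.in_own_span[OF bilinear_relations_closed] by blast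

lemma tensor_closed:
  "x \<in> carrier M \<Longrightarrow> y \<in> carrier N \<Longrightarrow> tensor R M N x y \<in> carrier (tensor_product R M N)"
  unfolding tensor_def tensor_product_def by (rule coset_in_carrier) (rule gen_closed)

lemma tensor_bilinear: "bilinear_map R M N (tensor_product R M N) (tensor R M N)"
  unfolding bilinear_map_def
proof (intro conjI ballI)
  fix x assume x: "x \<in> carrier M"
  show "tensor R M N x \<in> module_hom R N (tensor_product R M N)"
  proof (rule module_homI)
    fix y y' assume y: "y \<in> carrier N" "y' \<in> carrier N"
    have "e x (y \<oplus>\<^bsub>N\<^esub> y') \<ominus>\<^bsub>F\<^esub> (e x y \<oplus>\<^bsub>F\<^esub> e x y') \<in> bilinear_relations R M N"
      unfolding bilinear_relations_def Let_def
      by (rule UnI1, rule UnI1, rule UnI2, use x y in blast)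
    then show "tensor R M N x (y \<oplus>\<^bsub>N\<^esub> y') = tensor R M N x y \<oplus>\<^bsub>tensor_product R M N\<^esub> tensor R M N x y'"
      using x y unfolding tensor_def tensor_product_def
      by (simp add: coset_add gen_closed coset_eqI relations_subset)
  next
    fix r y assume y: "r \<in> carrier R" "y \<in> carrier N"
    have "e x (r \<odot>\<^bsub>N\<^esub> y) \<ominus>\<^bsub>F\<^esub> r \<odot>\<^bsub>F\<^esub> e x y \<in> bilinear_relations R M N"
      unfolding bilinear_relations_def Let_def
      by (rule UnI2, use x y in blast)
    then show "tensor R M N x (r \<odot>\<^bsub>N\<^esub> y) = r \<odot>\<^bsub>tensor_product R M N\<^esub> tensor R M N x y"
      using x y unfolding tensor_def tensor_product_def
      by (simp add: coset_smult gen_closed coset_eqI relations_subset)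
  qed (simp add: tensor_closed x)
next
  fix y assume y: "y \<in> carrier N"
  show "(\<lambda>x. tensor R M N x y) \<in> module_hom R M (tensor_product R M N)"
  proof (rule module_homI)
    fix x x' assume x: "x \<in> carrier M" "x' \<in> carrier M"
    have "e (x \<oplus>\<^bsub>M\<^esub> x') y \<ominus>\<^bsub>F\<^esub> (e x y \<oplus>\<^bsub>F\<^esub> e x' y) \<in> bilinear_relations R M N"
      unfolding bilinear_relations_def Let_def
      by (rule UnI1, rule UnI1, rule UnI1, use x y in blast)
    then show "tensor R M N (x \<oplus>\<^bsub>M\<^esub> x') y = tensor R M N x y \<oplus>\<^bsub>tensor_product R M N\<^esub> tensor R M N x' y"
      using x y unfolding tensor_def tensor_product_def
      by (simp add: coset_add gen_closed coset_eqI relations_subset)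
  next
    fix r x assume x: "r \<in> carrier R" "x \<in> carrier M"
    have "e (r \<odot>\<^bsub>M\<^esub> x) y \<ominus>\<^bsub>F\<^esub> r \<odot>\<^bsub>F\<^esub> e x y \<in> bilinear_relations R M N"
      unfolding bilinear_relations_def Let_def
      by (rule UnI1, rule UnI2, use x y in blast)
    then show "tensor R M N (r \<odot>\<^bsub>M\<^esub> x) y = r \<odot>\<^bsub>tensor_product R M N\<^esub> tensor R M N x y"
      using x y unfolding tensor_def tensor_product_def
      by (simp add: coset_smult gen_closed coset_eqI relations_subset)
  qed (simp add: tensor_closed y)
qed

lemmas tensor_hom_left = bilinear_mapD(2)[OF tensor_bilinear]
lemmas tensor_hom_right = bilinear_mapD(1)[OF tensor_bilinear]

text \<open>Uniqueness half of the universal property: composed with the projection, both maps start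
  at the free module, whose generators project to the pure tensors. Most later identities between
  tensors are reduced to pure tensors by writing both sides as linear maps and applying this
  rule.\<close>

lemma tensor_hom_eqI:
  assumes P: "module R P" and h: "h \<in> module_hom R (tensor_product R M N) P"
    and k: "k \<in> module_hom R (tensor_product R M N) P"
    and eq: "\<And>x y. x \<in> carrier M \<Longrightarrow> y \<in> carrier N \<Longrightarrow> h (tensor R M N x y) = k (tensor R M N x y)"
    and w: "w \<in> carrier (tensor_product R M N)"
  shows "h w = k w"
proof -
  obtain f where f: "f \<in> carrier F" and w_eq: "w = bilinear_submodule R M N +>\<^bsub>F\<^esub> f"
    using w unfolding tensor_product_def by (rule carrier_cosetE)
  note compose = module_hom_compose[OF coset_hom, folded tensor_product_def]
  show ?thesis
    unfolding w_eq
    by (rule free_module_hom_eqI[OF P compose[OF h] compose[OF k] _ f])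
      (auto simp: eq simp flip: tensor_def)
qed

text \<open>Existence half of the universal property. Bilinearity says exactly that the linear
  extension of \<open>b\<close> to the free module kills the four families of relations; its kernel
  is a submodule and hence contains their span.\<close>

lemma tensor_lift_exists:
  assumes P: "module R P" and b: "bilinear_map R M N P b"
  obtains h where "h \<in> module_hom R (tensor_product R M N) P"
    and "\<And>x y. x \<in> carrier M \<Longrightarrow> y \<in> carrier N \<Longrightarrow> h (tensor R M N x y) = b x y"
proof -
  interpret P: module R P by (rule P)
  note b_left = bilinear_mapD(2)[OF b] and b_right = bilinear_mapD(1)[OF b]
  note closed = module_hom_closedD[OF b_right]
  obtain g where g: "g \<in> module_hom R F P" and g_gen: "\<And>p. p \<in> carrier M \<times> carrier N \<Longrightarrow> g (free_gen R p) = b (fst p) (snd p)"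
    by (rule free_module_lift[OF P, of "carrier M \<times> carrier N" "\<lambda>p. b (fst p) (snd p)"]) (auto simp: closed)
  interpret g: mod_hom R F P g
    by (rule mod_homI[OF F.module_axioms P g])
  have "bilinear_relations R M N \<subseteq> g.ker"
  proof
    fix u assume "u \<in> bilinear_relations R M N"
    then show "u \<in> g.ker"
      by (cases rule: bilinear_relations_cases)
        (simp_all add: g.ker_def gen_closed g_gen closed
          module_hom_add[OF b_left] module_hom_add[OF b_right]
          module_hom_smult[OF b_left] module_hom_smult[OF b_right])
  qed
  then have "bilinear_submodule R M N \<subseteq> g.ker"
    unfolding bilinear_submodule_def by (intro F.span_is_subset g.ker_is_submodule)
  then obtain h where "h \<in> module_hom R (quotient_module F (bilinear_submodule R M N)) P"
    and "\<And>f. f \<in> carrier F \<Longrightarrow> h (bilinear_submodule R M N +>\<^bsub>F\<^esub> f) = g f"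
    using quotient_module_lift[OF P g] by (auto simp: g.ker_def subset_iff)
  then show ?thesis
    using that[of h] by (simp add: tensor_product_def tensor_def gen_closed g_gen)
qed

text \<open>\<open>tensor_lift\<close> is a definite description, so both halves of the universal
  property are needed before it has any property at all. Extensionality turns agreement on the
  carrier into equality of functions.\<close>

lemma tensor_lift:
  assumes P: "module R P" and b: "bilinear_map R M N P b"
  shows tensor_lift_hom: "tensor_lift R M N P b \<in> module_hom R (tensor_product R M N) P"
    and tensor_lift_extensional: "tensor_lift R M N P b \<in> extensional (carrier (tensor_product R M N))"
    and tensor_lift_tensor: "x \<in> carrier M \<Longrightarrow> y \<in> carrier N \<Longrightarrow>
      tensor_lift R M N P b (tensor R M N x y) = b x y"
proof -
  let ?Q = "\<lambda>h. h \<in> module_hom R (tensor_product R M N) P \<inter> extensional (carrier (tensor_product R M N)) \<and>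
      (\<forall>x\<in>carrier M. \<forall>y\<in>carrier N. h (tensor R M N x y) = b x y)"
  obtain h where h: "h \<in> module_hom R (tensor_product R M N) P"
    and h_tensor: "\<And>x y. x \<in> carrier M \<Longrightarrow> y \<in> carrier N \<Longrightarrow> h (tensor R M N x y) = b x y"
    by (rule tensor_lift_exists[OF assms]) blast
  have "\<exists>!h. ?Q h"
  proof (rule ex1I)
    show "?Q (restrict h (carrier (tensor_product R M N)))"
      using module_hom_restrict[OF T.module_axioms h] by (simp add: h_tensor tensor_closed)
    fix k assume k: "?Q k"
    show "k = restrict h (carrier (tensor_product R M N))"
    proof (rule extensionalityI)
      fix w assume "w \<in> carrier (tensor_product R M N)"
      then show "k w = restrict h (carrier (tensor_product R M N)) w"
        using k tensor_hom_eqI[OF P _ h, of k w] by (simp add: h_tensor)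
    qed (use k in auto)
  qed
  then have "?Q (tensor_lift R M N P b)"
    unfolding tensor_lift_def by (rule theI')
  then show "tensor_lift R M N P b \<in> module_hom R (tensor_product R M N) P"
    and "tensor_lift R M N P b \<in> extensional (carrier (tensor_product R M N))"
    and "x \<in> carrier M \<Longrightarrow> y \<in> carrier N \<Longrightarrow> tensor_lift R M N P b (tensor R M N x y) = b x y"
    by auto
qed

text \<open>The currying principle: a lift inherits linear dependence on a parameter, because the
  two sides of each law are linear in \<open>w\<close> and agree on pure tensors. It produces lifts
  of trilinear maps and maps with values in a dual.\<close>

lemma tensor_lift_family_hom:
  assumes A: "module R A" and P: "module R P"
    and b: "\<And>a. a \<in> carrier A \<Longrightarrow> bilinear_map R M N P (b a)"
    and lin: "\<And>x y. x \<in> carrier M \<Longrightarrow> y \<in> carrier N \<Longrightarrow> (\<lambda>a. b a x y) \<in> module_hom R A P"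
    and w: "w \<in> carrier (tensor_product R M N)"
  shows "(\<lambda>a. tensor_lift R M N P (b a) w) \<in> module_hom R A P"
proof -
  interpret A: module R A by (rule A)
  interpret P: module R P by (rule P)
  note hom = tensor_lift_hom[OF P b] and eval = tensor_lift_tensor[OF P b]
  show ?thesis
  proof (rule module_homI)
    fix a a' assume a: "a \<in> carrier A" and a': "a' \<in> carrier A"
    show "tensor_lift R M N P (b (a \<oplus>\<^bsub>A\<^esub> a')) w
        = tensor_lift R M N P (b a) w \<oplus>\<^bsub>P\<^esub> tensor_lift R M N P (b a') w"
    proof (rule tensor_hom_eqI[OF P hom[OF A.M.a_closed[OF a a']]
          module_hom_pointwise_add[OF T.module_axioms P hom[OF a] hom[OF a']] _ w])
      fix x y assume xy: "x \<in> carrier M" "y \<in> carrier N"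
      show "tensor_lift R M N P (b (a \<oplus>\<^bsub>A\<^esub> a')) (tensor R M N x y)
        = tensor_lift R M N P (b a) (tensor R M N x y) \<oplus>\<^bsub>P\<^esub> tensor_lift R M N P (b a') (tensor R M N x y)"
        using module_hom_add[OF lin[OF xy] a a'] eval[OF a xy] eval[OF a' xy]
          eval[OF A.M.a_closed[OF a a'] xy] by (simp only:)
    qed
  next
    fix r a assume r: "r \<in> carrier R" and a: "a \<in> carrier A"
    show "tensor_lift R M N P (b (r \<odot>\<^bsub>A\<^esub> a)) w = r \<odot>\<^bsub>P\<^esub> tensor_lift R M N P (b a) w"
    proof (rule tensor_hom_eqI[OF P hom[OF A.smult_closed[OF r a]]
          module_hom_pointwise_smult[OF P hom[OF a] r] _ w])
      fix x y assume xy: "x \<in> carrier M" "y \<in> carrier N"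
      show "tensor_lift R M N P (b (r \<odot>\<^bsub>A\<^esub> a)) (tensor R M N x y)
        = r \<odot>\<^bsub>P\<^esub> tensor_lift R M N P (b a) (tensor R M N x y)"
        using module_hom_smult[OF lin[OF xy] r a] eval[OF a xy]
          eval[OF A.smult_closed[OF r a] xy] by (simp only:)
    qed
  qed (rule module_hom_closedD[OF hom w])
qed

end

lemma tensor_map:
  assumes M: "module R M" and N: "module R N" and M': "module R M'" and N': "module R N'"
    and f: "f \<in> module_hom R M M'" and g: "g \<in> module_hom R N N'"
  shows tensor_map_hom: "tensor_map R M N M' N' f g \<in> module_hom R (tensor_product R M N) (tensor_product R M' N')"
    and tensor_map_tensor: "x \<in> carrier M \<Longrightarrow> y \<in> carrier N \<Longrightarrow>
      tensor_map R M N M' N' f g (tensor R M N x y) = tensor R M' N' (f x) (g y)"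
proof -
  have "bilinear_map R M N (tensor_product R M' N') (\<lambda>x y. tensor R M' N' (f x) (g y))"
    unfolding bilinear_map_def
  proof (intro conjI ballI)
    fix x assume x: "x \<in> carrier M"
    show "(\<lambda>y. tensor R M' N' (f x) (g y)) \<in> module_hom R N (tensor_product R M' N')"
      by (rule module_hom_compose[OF g tensor_hom_right[OF M' N' module_hom_closedD[OF f x]]])
  next
    fix y assume y: "y \<in> carrier N"
    show "(\<lambda>x. tensor R M' N' (f x) (g y)) \<in> module_hom R M (tensor_product R M' N')"
      by (rule module_hom_compose[OF f tensor_hom_left[OF M' N' module_hom_closedD[OF g y]]])
  qed
  note lift = tensor_lift[OF M N tensor_product_module[OF M' N'] this]
  show "tensor_map R M N M' N' f g \<in> module_hom R (tensor_product R M N) (tensor_product R M' N')"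
    and "x \<in> carrier M \<Longrightarrow> y \<in> carrier N \<Longrightarrow>
      tensor_map R M N M' N' f g (tensor R M N x y) = tensor R M' N' (f x) (g y)"
    unfolding tensor_map_def by (rule lift(1)) (rule lift(3))
qed

section \<open>The third tensor power\<close>

definition trilinear_map ::
    "('a, 'k) ring_scheme \<Rightarrow> ('a, 'b, 'm) module_scheme \<Rightarrow> ('a, 'd, 'p) module_scheme
      \<Rightarrow> ('b \<Rightarrow> 'b \<Rightarrow> 'b \<Rightarrow> 'd) \<Rightarrow> bool"
  where "trilinear_map R N P t \<longleftrightarrow>
    (\<forall>x\<in>carrier N. bilinear_map R N N P (t x)) \<and>
    (\<forall>y\<in>carrier N. \<forall>z\<in>carrier N. (\<lambda>x. t x y z) \<in> module_hom R N P)"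

lemma trilinear_mapD:
  assumes "trilinear_map R N P t"
  shows "x \<in> carrier N \<Longrightarrow> y \<in> carrier N \<Longrightarrow> t x y \<in> module_hom R N P"
    and "x \<in> carrier N \<Longrightarrow> bilinear_map R N N P (t x)"
    and "y \<in> carrier N \<Longrightarrow> z \<in> carrier N \<Longrightarrow> (\<lambda>x. t x y z) \<in> module_hom R N P"
    and "z \<in> carrier N \<Longrightarrow> bilinear_map R N N P (\<lambda>x y. t x y z)"
  using assms by (simp_all add: trilinear_map_def bilinear_map_def)

context
  fixes R :: "('a, 'k) ring_scheme" and N :: "('a, 'b, 'm) module_scheme"
  assumes N: "module R N"
begin

interpretation N: module R N by (rule N)

lemmas square_module = tensor_product_module[OF N N]
lemmas right_cube_module = tensor_product_module[OF N square_module]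

lemma tensor_cube_module: "module R (tensor_cube R N)"
  unfolding tensor_cube_def by (rule tensor_product_module[OF square_module N])

lemma tensor_triple_trilinear: "trilinear_map R N (tensor_cube R N) (tensor_triple R N)"
  unfolding trilinear_map_def bilinear_map_def tensor_cube_def tensor_triple_def
proof (intro conjI ballI)
  fix x y assume x: "x \<in> carrier N" and y: "y \<in> carrier N"
  then show "tensor R (tensor_product R N N) N (tensor R N N x y)
      \<in> module_hom R N (tensor_product R (tensor_product R N N) N)"
    by (intro tensor_hom_right[OF square_module N] tensor_closed[OF N N])
  show "(\<lambda>z. tensor R (tensor_product R N N) N (tensor R N N x z) y)
      \<in> module_hom R N (tensor_product R (tensor_product R N N) N)"
    by (rule module_hom_compose[OF tensor_hom_right[OF N N x] tensor_hom_left[OF square_module N y]])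
  show "(\<lambda>z. tensor R (tensor_product R N N) N (tensor R N N z x) y)
      \<in> module_hom R N (tensor_product R (tensor_product R N N) N)"
    by (rule module_hom_compose[OF tensor_hom_left[OF N N x] tensor_hom_left[OF square_module N y]])
qed

lemma tensor_triple_closed:
  "x \<in> carrier N \<Longrightarrow> y \<in> carrier N \<Longrightarrow> z \<in> carrier N \<Longrightarrow> tensor_triple R N x y z \<in> carrier (tensor_cube R N)"
  unfolding tensor_cube_def tensor_triple_def
  by (intro tensor_closed[OF square_module N] tensor_closed[OF N N])

text \<open>Uniqueness for two factors is used twice: inside with \<open>z\<close> fixed, then for
  the outer product.\<close>

lemma tensor_cube_hom_eqI:
  assumes P: "module R P" and h: "h \<in> module_hom R (tensor_cube R N) P"
    and k: "k \<in> module_hom R (tensor_cube R N) P"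
    and eq: "\<And>x y z. x \<in> carrier N \<Longrightarrow> y \<in> carrier N \<Longrightarrow> z \<in> carrier N \<Longrightarrow>
      h (tensor_triple R N x y z) = k (tensor_triple R N x y z)"
    and w: "w \<in> carrier (tensor_cube R N)"
  shows "h w = k w"
proof -
  have pure: "h (tensor R (tensor_product R N N) N u z) = k (tensor R (tensor_product R N N) N u z)"
    if u: "u \<in> carrier (tensor_product R N N)" and z: "z \<in> carrier N" for u z
  proof -
    note left = tensor_hom_left[OF square_module N z, folded tensor_cube_def]
    show ?thesis
      by (rule tensor_hom_eqI[OF N N P module_hom_compose[OF left h] module_hom_compose[OF left k] _ u])
        (rule eq[unfolded tensor_triple_def, OF _ _ z])
  qed
  show ?thesis
    by (rule tensor_hom_eqI[OF square_module N P, folded tensor_cube_def, OF h k pure w])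
qed

lemma tensor_cube_lift:
  assumes P: "module R P" and t: "trilinear_map R N P t"
  shows tensor_cube_lift_hom: "tensor_cube_lift R N P t \<in> module_hom R (tensor_cube R N) P"
    and tensor_cube_lift_triple: "x \<in> carrier N \<Longrightarrow> y \<in> carrier N \<Longrightarrow> z \<in> carrier N \<Longrightarrow>
      tensor_cube_lift R N P t (tensor_triple R N x y z) = t x y z"
proof -
  let ?Q = "\<lambda>h. h \<in> module_hom R (tensor_cube R N) P \<inter> extensional (carrier (tensor_cube R N)) \<and>
      (\<forall>x\<in>carrier N. \<forall>y\<in>carrier N. \<forall>z\<in>carrier N. h (tensor_triple R N x y z) = t x y z)"
  note b = trilinear_mapD(4)[OF t]
  \<comment> \<open>For fixed \<open>z\<close> the first two arguments are lifted; the resulting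
    family depends linearly on \<open>z\<close>, so it can be lifted once more.\<close>
  have "bilinear_map R (tensor_product R N N) N P (\<lambda>w z. tensor_lift R N N P (\<lambda>x y. t x y z) w)"
    unfolding bilinear_map_def
  proof (intro conjI ballI)
    fix w assume w: "w \<in> carrier (tensor_product R N N)"
    show "(\<lambda>z. tensor_lift R N N P (\<lambda>x y. t x y z) w) \<in> module_hom R N P"
      by (rule tensor_lift_family_hom[OF N N N P b trilinear_mapD(1)[OF t] w])
  qed (rule tensor_lift_hom[OF N N P b])
  note lift = tensor_lift[OF square_module N P this, folded tensor_cube_def]
  define h where "h = tensor_lift R (tensor_product R N N) N P (\<lambda>w z. tensor_lift R N N P (\<lambda>x y. t x y z) w)"
  have h: "h \<in> module_hom R (tensor_cube R N) P"
    unfolding h_def by (rule lift(1))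
  have h_triple: "h (tensor_triple R N x y z) = t x y z"
    if "x \<in> carrier N" "y \<in> carrier N" "z \<in> carrier N" for x y z
    using that unfolding h_def tensor_triple_def
    by (simp add: lift(3) tensor_closed[OF N N] tensor_lift_tensor[OF N N P b])
  have "?Q h"
    using h h_triple lift(2) by (simp add: h_def)
  moreover have "k = h" if "?Q k" for k
  proof (rule extensionalityI)
    fix w assume "w \<in> carrier (tensor_cube R N)"
    then show "k w = h w"
      using tensor_cube_hom_eqI[OF P _ h, of k w] that h_triple by simp
  qed (use that \<open>?Q h\<close> in auto)
  ultimately have "?Q (tensor_cube_lift R N P t)"
    unfolding tensor_cube_lift_def by (rule theI2)
  then show "tensor_cube_lift R N P t \<in> module_hom R (tensor_cube R N) P"
    and "x \<in> carrier N \<Longrightarrow> y \<in> carrier N \<Longrightarrow> z \<in> carrier N \<Longrightarrow>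
      tensor_cube_lift R N P t (tensor_triple R N x y z) = t x y z"
    by auto
qed

lemma tensor_assoc_trilinear:
  "trilinear_map R N (tensor_product R N (tensor_product R N N))
    (\<lambda>x y z. tensor R N (tensor_product R N N) x (tensor R N N y z))"
  unfolding trilinear_map_def bilinear_map_def
proof (intro conjI ballI)
  fix x y assume x: "x \<in> carrier N" and y: "y \<in> carrier N"
  show "(\<lambda>z. tensor R N (tensor_product R N N) x (tensor R N N y z))
      \<in> module_hom R N (tensor_product R N (tensor_product R N N))"
    by (rule module_hom_compose[OF tensor_hom_right[OF N N y] tensor_hom_right[OF N square_module x]])
  show "(\<lambda>z. tensor R N (tensor_product R N N) x (tensor R N N z y))
      \<in> module_hom R N (tensor_product R N (tensor_product R N N))"
    by (rule module_hom_compose[OF tensor_hom_left[OF N N y] tensor_hom_right[OF N square_module x]])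
  show "(\<lambda>z. tensor R N (tensor_product R N N) z (tensor R N N x y))
      \<in> module_hom R N (tensor_product R N (tensor_product R N N))"
    by (rule tensor_hom_left[OF N square_module tensor_closed[OF N N x y]])
qed

lemmas tensor_assoc_hom = tensor_cube_lift_hom[OF right_cube_module tensor_assoc_trilinear, folded tensor_assoc_def]
lemmas tensor_assoc_triple = tensor_cube_lift_triple[OF right_cube_module tensor_assoc_trilinear, folded tensor_assoc_def]

text \<open>A value of \<open>inv_into\<close> cannot be computed from its definition. An explicit
  inverse \<open>g\<close> is therefore built by currying from the other side, with \<open>x\<close>
  fixed and the last two arguments lifted first, and \<open>inv_into\<close> is then shown to agree
  with it.\<close>

lemma tensor_assoc_inv:
  shows tensor_assoc_inv_hom:
      "tensor_assoc_inv R N \<in> module_hom R (tensor_product R N (tensor_product R N N)) (tensor_cube R N)"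
    and tensor_assoc_inv_tensor: "x \<in> carrier N \<Longrightarrow> y \<in> carrier N \<Longrightarrow> z \<in> carrier N \<Longrightarrow>
      tensor_assoc_inv R N (tensor R N (tensor_product R N N) x (tensor R N N y z)) = tensor_triple R N x y z"
proof -
  note C = tensor_cube_module and T = right_cube_module
  define b where "b x = tensor_lift R N N (tensor_cube R N) (tensor_triple R N x)" for x
  note triple = trilinear_mapD(2)[OF tensor_triple_trilinear]
  have "bilinear_map R N (tensor_product R N N) (tensor_cube R N) b"
    unfolding bilinear_map_def b_def
  proof (intro conjI ballI)
    fix w assume w: "w \<in> carrier (tensor_product R N N)"
    show "(\<lambda>x. tensor_lift R N N (tensor_cube R N) (tensor_triple R N x) w) \<in> module_hom R N (tensor_cube R N)"
      by (rule tensor_lift_family_hom[OF N N N C triple trilinear_mapD(3)[OF tensor_triple_trilinear] w])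
  qed (rule tensor_lift_hom[OF N N C triple])
  note lift = tensor_lift[OF N square_module C this]
  define g where "g = tensor_lift R N (tensor_product R N N) (tensor_cube R N) b"
  have g: "g \<in> module_hom R (tensor_product R N (tensor_product R N N)) (tensor_cube R N)"
    unfolding g_def by (rule lift(1))
  have g_tensor: "g (tensor R N (tensor_product R N N) x (tensor R N N y z)) = tensor_triple R N x y z"
    if "x \<in> carrier N" "y \<in> carrier N" "z \<in> carrier N" for x y z
    using that unfolding g_def by (simp add: lift(3) b_def tensor_lift_tensor[OF N N C triple] tensor_closed[OF N N])
  have g_assoc: "g (tensor_assoc R N t) = id t" if "t \<in> carrier (tensor_cube R N)" for t
    by (rule tensor_cube_hom_eqI[OF C module_hom_compose[OF tensor_assoc_hom g] module_hom_id _ that])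
      (simp add: tensor_assoc_triple g_tensor)
  \<comment> \<open>These tensors are bracketed to the right, so \<open>tensor_cube_hom_eqI\<close>
    does not apply; the two reductions to pure tensors are done by hand.\<close>
  have assoc_g: "tensor_assoc R N (g u) = id u" if "u \<in> carrier (tensor_product R N (tensor_product R N N))" for u
  proof (rule tensor_hom_eqI[OF N square_module T module_hom_compose[OF g tensor_assoc_hom] module_hom_id _ that])
    fix x w assume x: "x \<in> carrier N" and w: "w \<in> carrier (tensor_product R N N)"
    note right = tensor_hom_right[OF N square_module x]
    show "tensor_assoc R N (g (tensor R N (tensor_product R N N) x w)) = id (tensor R N (tensor_product R N N) x w)"
      by (rule tensor_hom_eqI[OF N N T
            module_hom_compose[OF module_hom_compose[OF right g] tensor_assoc_hom]
            module_hom_compose[OF right module_hom_id] _ w])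
        (simp add: x tensor_assoc_triple g_tensor)
  qed
  \<comment> \<open>The identity \<open>g_assoc\<close> gives injectivity of
    \<open>tensor_assoc\<close>, and \<open>assoc_g\<close> exhibits \<open>g u\<close> as a
    preimage of \<open>u\<close>.\<close>
  have inv_eq: "tensor_assoc_inv R N u = g u" if u: "u \<in> carrier (tensor_product R N (tensor_product R N N))" for u
    unfolding tensor_assoc_inv_def
  proof (rule inv_into_f_eq)
    show "inj_on (tensor_assoc R N) (carrier (tensor_cube R N))"
      by (rule inj_on_inverseI[of _ g]) (simp add: g_assoc)
  qed (use assoc_g[OF u] module_hom_closedD[OF g u] in simp_all)
  show "tensor_assoc_inv R N \<in> module_hom R (tensor_product R N (tensor_product R N N)) (tensor_cube R N)"
    by (rule iffD2[OF module_hom_cong[OF T, of "tensor_assoc_inv R N" g, OF inv_eq] g])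
  show "x \<in> carrier N \<Longrightarrow> y \<in> carrier N \<Longrightarrow> z \<in> carrier N \<Longrightarrow>
      tensor_assoc_inv R N (tensor R N (tensor_product R N N) x (tensor R N N y z)) = tensor_triple R N x y z"
    by (simp add: inv_eq g_tensor tensor_closed[OF N square_module] tensor_closed[OF N N])
qed

end

section \<open>Dual modules\<close>

lemma dual_module_simps:
  "carrier (dual_module R M) = module_hom R M (regular_module R) \<inter> extensional (carrier M)"
  "\<zero>\<^bsub>dual_module R M\<^esub> = (\<lambda>x\<in>carrier M. \<zero>\<^bsub>R\<^esub>)"
  "f \<oplus>\<^bsub>dual_module R M\<^esub> g = (\<lambda>x\<in>carrier M. f x \<oplus>\<^bsub>R\<^esub> g x)"
  "r \<odot>\<^bsub>dual_module R M\<^esub> f = (\<lambda>x\<in>carrier M. r \<otimes>\<^bsub>R\<^esub> f x)"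
  by (simp_all add: dual_module_def)

lemma dual_hom: "f \<in> carrier (dual_module R M) \<Longrightarrow> f \<in> module_hom R M (regular_module R)"
  by (simp add: dual_module_simps)

lemma dual_closed: "f \<in> carrier (dual_module R M) \<Longrightarrow> x \<in> carrier M \<Longrightarrow> f x \<in> carrier R"
  using module_hom_closedD[OF dual_hom] by fastforce

lemma dual_eqI:
  assumes "f \<in> carrier (dual_module R M)" and "g \<in> carrier (dual_module R M)"
    and "\<And>x. x \<in> carrier M \<Longrightarrow> f x = g x"
  shows "f = g"
  using assms by (auto simp: dual_module_simps intro: extensionalityI)

lemma dual_restrictI:
  assumes "module R M" and "f \<in> module_hom R M (regular_module R)"
  shows "restrict f (carrier M) \<in> carrier (dual_module R M)"
  using module_hom_restrict[OF assms] by (simp add: dual_module_simps)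

context
  fixes R :: "('a, 'k) ring_scheme" and M :: "('a, 'b, 'm) module_scheme"
  assumes M: "module R M"
begin

interpretation M: module R M by (rule M)

lemma ring_module: "module R (regular_module R)"
  by (rule regular_module_module) (rule M.R.is_cring)

lemma dual_module_module: "module R (dual_module R M)"
proof -
  have smult: "(\<lambda>x\<in>carrier M. r \<otimes>\<^bsub>R\<^esub> f x) \<in> carrier (dual_module R M)"
    if "r \<in> carrier R" and "f \<in> carrier (dual_module R M)" for r f
    using dual_restrictI[OF M module_hom_pointwise_smult[OF ring_module dual_hom[OF that(2)] that(1)]]
    by simp
  have add: "(\<lambda>x\<in>carrier M. f x \<oplus>\<^bsub>R\<^esub> g x) \<in> carrier (dual_module R M)"
    if "f \<in> carrier (dual_module R M)" and "g \<in> carrier (dual_module R M)" for f g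
    using dual_restrictI[OF M module_hom_pointwise_add[OF M ring_module dual_hom[OF that(1)] dual_hom[OF that(2)]]]
    by simp
  have zero: "(\<lambda>x\<in>carrier M. \<zero>\<^bsub>R\<^esub>) \<in> carrier (dual_module R M)"
    by (rule dual_restrictI[OF M]) (auto intro: module_homI)
  \<comment> \<open>The operations return restricted functions. In the two unit laws the bare
    \<open>f\<close> on the right must therefore be rewritten as its own restriction before values
    can be compared.\<close>
  have ext: "f = (\<lambda>x\<in>carrier M. f x)" if "f \<in> carrier (dual_module R M)" for f
    using that by (simp add: dual_module_simps extensional_restrict)
  have neg: "\<exists>g\<in>carrier (dual_module R M). f \<oplus>\<^bsub>dual_module R M\<^esub> g = \<zero>\<^bsub>dual_module R M\<^esub>"
    if f: "f \<in> carrier (dual_module R M)" for f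
  proof (rule bexI[OF _ smult[OF _ f]])
    show "f \<oplus>\<^bsub>dual_module R M\<^esub> (\<lambda>x\<in>carrier M. (\<ominus>\<^bsub>R\<^esub> \<one>\<^bsub>R\<^esub>) \<otimes>\<^bsub>R\<^esub> f x) = \<zero>\<^bsub>dual_module R M\<^esub>"
      unfolding dual_module_simps
      by (rule restrict_ext) (simp add: dual_closed[OF f] M.R.l_minus M.R.r_neg)
  qed simp
  show ?thesis
  proof (rule module_criteria)
    show "\<forall>f\<in>carrier (dual_module R M). f \<oplus>\<^bsub>dual_module R M\<^esub> \<zero>\<^bsub>dual_module R M\<^esub> = f"
      by (intro ballI, subst (3) ext) (auto simp: dual_module_simps(2,3) dual_closed intro!: restrict_ext)
    show "\<forall>f\<in>carrier (dual_module R M). \<one>\<^bsub>R\<^esub> \<odot>\<^bsub>dual_module R M\<^esub> f = f"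
      by (intro ballI, subst (3) ext) (auto simp: dual_module_simps(4) dual_closed intro!: restrict_ext)
    show "\<forall>v w. v \<in> carrier (dual_module R M) \<and> w \<in> carrier (dual_module R M) \<longrightarrow> v \<oplus>\<^bsub>dual_module R M\<^esub> w \<in> carrier (dual_module R M)"
      by (simp only: dual_module_simps(3)) (blast intro: add)
    show "\<forall>a v. a \<in> carrier R \<and> v \<in> carrier (dual_module R M) \<longrightarrow> a \<odot>\<^bsub>dual_module R M\<^esub> v \<in> carrier (dual_module R M)"
      by (simp only: dual_module_simps(4)) (blast intro: smult)
    show "\<zero>\<^bsub>dual_module R M\<^esub> \<in> carrier (dual_module R M)"
      by (simp only: dual_module_simps(2) zero)
    show "\<forall>v w. v \<in> carrier (dual_module R M) \<and> w \<in> carrier (dual_module R M) \<longrightarrow> v \<oplus>\<^bsub>dual_module R M\<^esub> w = w \<oplus>\<^bsub>dual_module R M\<^esub> v"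
      by (intro allI impI, elim conjE, unfold dual_module_simps(3,4), rule restrict_ext)
        (simp add: dual_closed[where M = M] M.R.a_comm)
    show "\<forall>u v w. u \<in> carrier (dual_module R M) \<and> v \<in> carrier (dual_module R M) \<and> w \<in> carrier (dual_module R M) \<longrightarrow>
        u \<oplus>\<^bsub>dual_module R M\<^esub> v \<oplus>\<^bsub>dual_module R M\<^esub> w = u \<oplus>\<^bsub>dual_module R M\<^esub> (v \<oplus>\<^bsub>dual_module R M\<^esub> w)"
      by (intro allI impI, elim conjE, unfold dual_module_simps(3,4), rule restrict_ext)
        (simp add: dual_closed[where M = M] M.R.a_assoc)
    show "\<forall>a b v. a \<in> carrier R \<and> b \<in> carrier R \<and> v \<in> carrier (dual_module R M) \<longrightarrow>
        (a \<otimes>\<^bsub>R\<^esub> b) \<odot>\<^bsub>dual_module R M\<^esub> v = a \<odot>\<^bsub>dual_module R M\<^esub> (b \<odot>\<^bsub>dual_module R M\<^esub> v)"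
      by (intro allI impI, elim conjE, unfold dual_module_simps(3,4), rule restrict_ext)
        (simp add: dual_closed[where M = M] M.R.m_assoc)
    show "\<forall>a b v. a \<in> carrier R \<and> b \<in> carrier R \<and> v \<in> carrier (dual_module R M) \<longrightarrow>
        (a \<oplus>\<^bsub>R\<^esub> b) \<odot>\<^bsub>dual_module R M\<^esub> v = a \<odot>\<^bsub>dual_module R M\<^esub> v \<oplus>\<^bsub>dual_module R M\<^esub> b \<odot>\<^bsub>dual_module R M\<^esub> v"
      by (intro allI impI, elim conjE, unfold dual_module_simps(3,4), rule restrict_ext)
        (simp add: dual_closed[where M = M] M.R.l_distr)
    show "\<forall>a v w. a \<in> carrier R \<and> v \<in> carrier (dual_module R M) \<and> w \<in> carrier (dual_module R M) \<longrightarrow>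
        a \<odot>\<^bsub>dual_module R M\<^esub> (v \<oplus>\<^bsub>dual_module R M\<^esub> w) = a \<odot>\<^bsub>dual_module R M\<^esub> v \<oplus>\<^bsub>dual_module R M\<^esub> a \<odot>\<^bsub>dual_module R M\<^esub> w"
      by (intro allI impI, elim conjE, unfold dual_module_simps(3,4), rule restrict_ext)
        (simp add: dual_closed[where M = M] M.R.r_distr)
  qed (use neg M.R.is_cring in blast)+
qed

lemma dual_eval_hom:
  assumes "x \<in> carrier M"
  shows "(\<lambda>f. f x) \<in> module_hom R (dual_module R M) (regular_module R)"
  using assms by (intro module_homI) (simp_all add: dual_closed dual_module_simps(3,4))

text \<open>Forms are equal when their values are, so linearity into a dual reduces to linearity of
  each value.\<close>

lemma dual_valued_homI:
  assumes "\<And>a. a \<in> carrier A \<Longrightarrow> h a \<in> carrier (dual_module R M)"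
    and "module R A"
    and lin: "\<And>x. x \<in> carrier M \<Longrightarrow> (\<lambda>a. h a x) \<in> module_hom R A (regular_module R)"
  shows "h \<in> module_hom R A (dual_module R M)"
proof -
  interpret A: module R A by fact
  interpret D: module R "dual_module R M" by (rule dual_module_module)
  show ?thesis
  proof (rule module_homI)
    fix a a' assume a: "a \<in> carrier A" "a' \<in> carrier A"
    show "h (a \<oplus>\<^bsub>A\<^esub> a') = h a \<oplus>\<^bsub>dual_module R M\<^esub> h a'"
    proof (rule dual_eqI[where R = R and M = M])
      fix x assume x: "x \<in> carrier M"
      show "h (a \<oplus>\<^bsub>A\<^esub> a') x = (h a \<oplus>\<^bsub>dual_module R M\<^esub> h a') x"
        using module_hom_add[OF lin[OF x] a] x by (simp add: dual_module_simps(3))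
    qed (use a in \<open>simp_all add: assms(1)\<close>)
  next
    fix r a assume a: "r \<in> carrier R" "a \<in> carrier A"
    show "h (r \<odot>\<^bsub>A\<^esub> a) = r \<odot>\<^bsub>dual_module R M\<^esub> h a"
    proof (rule dual_eqI[where R = R and M = M])
      fix x assume x: "x \<in> carrier M"
      show "h (r \<odot>\<^bsub>A\<^esub> a) x = (r \<odot>\<^bsub>dual_module R M\<^esub> h a) x"
        using module_hom_smult[OF lin[OF x] a] x by (simp add: dual_module_simps(4))
    qed (use a in \<open>simp_all add: assms(1)\<close>)
  qed (rule assms(1))
qed

end

text \<open>The data of the dual basis lemma: what is recorded is the expansion of vectors, from
  which the expansions of forms and of tensors are derived.\<close>

definition dual_basis ::
    "('a, 'k) ring_scheme \<Rightarrow> ('a, 'b, 'm) module_scheme \<Rightarrow> 'b set \<Rightarrow> ('b \<Rightarrow> 'b \<Rightarrow> 'a) \<Rightarrow> bool"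
  where "dual_basis R M B \<delta> \<longleftrightarrow>
    finite B \<and> B \<subseteq> carrier M \<and> \<delta> \<in> B \<rightarrow> carrier (dual_module R M) \<and>
    (\<forall>x\<in>carrier M. x = (\<Oplus>\<^bsub>M\<^esub>b\<in>B. \<delta> b x \<odot>\<^bsub>M\<^esub> b))"

lemma dual_basisD:
  assumes "dual_basis R M B \<delta>"
  shows "b \<in> B \<Longrightarrow> b \<in> carrier M" and "b \<in> B \<Longrightarrow> \<delta> b \<in> carrier (dual_module R M)"
    and "x \<in> carrier M \<Longrightarrow> x = (\<Oplus>\<^bsub>M\<^esub>b\<in>B. \<delta> b x \<odot>\<^bsub>M\<^esub> b)"
  using assms unfolding dual_basis_def by blast+

text \<open>The span condition provides coordinates, and independence makes them unique; uniqueness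
  is what turns chosen coordinates into linear forms.\<close>

lemma free_of_finite_type_dual_basis:
  assumes M: "module R M" and "free_of_finite_type R M"
  obtains B \<delta> where "dual_basis R M B \<delta>"
proof -
  interpret M: module R M by (rule M)
  obtain B where B: "B \<subseteq> carrier M" and fin: "finite B" and indep: "\<not> M.lin_dep B"
    and span: "M.span B = carrier M"
    using assms(2) unfolding free_of_finite_type_def by blast
  \<comment> \<open>The difference of two representations, written with the scalar -1, is a
    vanishing combination, so independence kills its coefficients.\<close>
  have unique: "a b = a' b"
    if a: "a \<in> B \<rightarrow> carrier R" and a': "a' \<in> B \<rightarrow> carrier R"
      and eq: "M.lincomb a B = M.lincomb a' B" and b: "b \<in> B" for a a' b
  proof -
    have neg: "(\<lambda>v. \<ominus>\<^bsub>R\<^esub> \<one>\<^bsub>R\<^esub> \<otimes>\<^bsub>R\<^esub> a' v) \<in> B \<rightarrow> carrier R"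
      using a' by auto
    have "M.lincomb (\<lambda>v. a v \<oplus>\<^bsub>R\<^esub> \<ominus>\<^bsub>R\<^esub> \<one>\<^bsub>R\<^esub> \<otimes>\<^bsub>R\<^esub> a' v) B
        = M.lincomb a B \<oplus>\<^bsub>M\<^esub> \<ominus>\<^bsub>R\<^esub> \<one>\<^bsub>R\<^esub> \<odot>\<^bsub>M\<^esub> M.lincomb a' B"
      using a' by (simp add: M.lincomb_sum[OF fin B a neg] M.lincomb_smult[OF B])
    then have "M.lincomb (\<lambda>v. a v \<oplus>\<^bsub>R\<^esub> \<ominus>\<^bsub>R\<^esub> \<one>\<^bsub>R\<^esub> \<otimes>\<^bsub>R\<^esub> a' v) B = \<zero>\<^bsub>M\<^esub>"
      using M.lincomb_closed[OF B a'] by (simp add: eq M.smult_minus_1 M.M.r_neg)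
    moreover have "(\<lambda>v. a v \<oplus>\<^bsub>R\<^esub> \<ominus>\<^bsub>R\<^esub> \<one>\<^bsub>R\<^esub> \<otimes>\<^bsub>R\<^esub> a' v) \<in> B \<rightarrow> carrier R"
      using a neg by auto
    ultimately have "a b \<oplus>\<^bsub>R\<^esub> \<ominus>\<^bsub>R\<^esub> \<one>\<^bsub>R\<^esub> \<otimes>\<^bsub>R\<^esub> a' b = \<zero>\<^bsub>R\<^esub>"
      using M.lin_dep_crit[OF fin subset_refl _ b] indep by blast
    moreover have "a b \<in> carrier R" "a' b \<in> carrier R"
      using a a' b by auto
    ultimately show ?thesis
      using M.R.minus_other_side[of "a b" "a' b"] by (simp add: M.R.l_minus a_minus_def)
  qed
  define c where "c x = (SOME a. a \<in> B \<rightarrow> carrier R \<and> M.lincomb a B = x)" for x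
  have c: "c x \<in> B \<rightarrow> carrier R \<and> M.lincomb (c x) B = x" if "x \<in> carrier M" for x
    unfolding c_def by (rule someI_ex[OF M.finite_in_span[OF fin B]]) (simp only: span that)
  \<comment> \<open>Any coefficients that represent \<open>x\<close> are the chosen ones. Linearity
    of the coordinates follows by exhibiting the sum or multiple of coefficients as a
    representation.\<close>
  have c_eq: "c x b = a b" if "a \<in> B \<rightarrow> carrier R" "M.lincomb a B = x" "b \<in> B" for a x b
  proof -
    have x: "x \<in> carrier M"
      using M.lincomb_closed[OF B that(1)] that(2) by (simp only:)
    show ?thesis
      using conjunct2[OF c[OF x]] that(2)
      by (intro unique[OF conjunct1[OF c[OF x]] that(1) _ that(3)]) (simp only:)
  qed
  define \<delta> where "\<delta> b = (\<lambda>x\<in>carrier M. c x b)" for b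
  have \<delta>: "\<delta> b \<in> carrier (dual_module R M)" if b: "b \<in> B" for b
    unfolding \<delta>_def
  proof (rule dual_restrictI[OF M], rule module_homI)
    fix x assume "x \<in> carrier M"
    then show "c x b \<in> carrier (regular_module R)" using funcset_mem[OF conjunct1[OF c] b] by simp
  next
    fix x y assume "x \<in> carrier M" "y \<in> carrier M"
    then have cx: "c x \<in> B \<rightarrow> carrier R" "M.lincomb (c x) B = x"
      and cy: "c y \<in> B \<rightarrow> carrier R" "M.lincomb (c y) B = y" using c by auto
    have "(\<lambda>v. c x v \<oplus>\<^bsub>R\<^esub> c y v) \<in> B \<rightarrow> carrier R" using cx(1) cy(1) by auto
    moreover have "M.lincomb (\<lambda>v. c x v \<oplus>\<^bsub>R\<^esub> c y v) B = x \<oplus>\<^bsub>M\<^esub> y"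
      unfolding M.lincomb_sum[OF fin B cx(1) cy(1)] cx(2) cy(2) ..
    ultimately show "c (x \<oplus>\<^bsub>M\<^esub> y) b = c x b \<oplus>\<^bsub>regular_module R\<^esub> c y b"
      unfolding regular_module_simps by (rule c_eq[OF _ _ b])
  next
    fix r x assume r: "r \<in> carrier R" and "x \<in> carrier M"
    then have cx: "c x \<in> B \<rightarrow> carrier R" "M.lincomb (c x) B = x" using c by auto
    have "(\<lambda>v. r \<otimes>\<^bsub>R\<^esub> c x v) \<in> B \<rightarrow> carrier R" using cx(1) r by auto
    moreover have "M.lincomb (\<lambda>v. r \<otimes>\<^bsub>R\<^esub> c x v) B = r \<odot>\<^bsub>M\<^esub> x"
      unfolding M.lincomb_smult[OF B cx(1) r] cx(2) ..
    ultimately show "c (r \<odot>\<^bsub>M\<^esub> x) b = r \<odot>\<^bsub>regular_module R\<^esub> c x b"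
      unfolding regular_module_simps by (rule c_eq[OF _ _ b])
  qed
  have expand: "x = (\<Oplus>\<^bsub>M\<^esub>b\<in>B. \<delta> b x \<odot>\<^bsub>M\<^esub> b)" if "x \<in> carrier M" for x
    using conjunct2[OF c[OF that], symmetric]
    unfolding M.lincomb_def \<delta>_def restrict_apply'[OF that] .
  have "dual_basis R M B \<delta>"
    unfolding dual_basis_def by (intro conjI ballI funcsetI fin B \<delta> expand)
  then show ?thesis by (rule that)
qed

lemma dual_expansion:
  assumes M: "module R M" and basis: "dual_basis R M B \<delta>" and f: "f \<in> carrier (dual_module R M)"
  shows "f = (\<Oplus>\<^bsub>dual_module R M\<^esub>b\<in>B. f b \<odot>\<^bsub>dual_module R M\<^esub> \<delta> b)"
proof -
  interpret M: module R M by (rule M)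
  interpret D: module R "dual_module R M" by (rule dual_module_module[OF M])
  note reg = ring_module[OF M]
  note B = dual_basisD(1)[OF basis] and \<delta> = dual_basisD(2)[OF basis] and expand = dual_basisD(3)[OF basis]
  have summand: "(\<lambda>b. f b \<odot>\<^bsub>dual_module R M\<^esub> \<delta> b) \<in> B \<rightarrow> carrier (dual_module R M)"
    by (intro funcsetI D.smult_closed dual_closed[OF f] B \<delta>)
  show ?thesis
  proof (rule dual_eqI[OF f D.finsum_closed[OF summand]])
    fix x assume x: "x \<in> carrier M"
    have \<delta>x: "\<delta> b x \<in> carrier R" if "b \<in> B" for b
      using dual_closed[OF \<delta>[OF that] x] .
    \<comment> \<open>Applying \<open>f\<close> to the expansion of \<open>x\<close> gives products
      of \<open>\<delta> b x\<close> with \<open>f b\<close>; commutativity of \<open>R\<close> lets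
      them be read as values of multiples of \<open>\<delta> b\<close>.\<close>
    have "f x = f (\<Oplus>\<^bsub>M\<^esub>b\<in>B. \<delta> b x \<odot>\<^bsub>M\<^esub> b)"
      by (rule arg_cong[OF expand[OF x]])
    also have "\<dots> = (\<Oplus>\<^bsub>regular_module R\<^esub>b\<in>B. f (\<delta> b x \<odot>\<^bsub>M\<^esub> b))"
      by (intro module_hom_finsum[OF M reg dual_hom[OF f]] funcsetI M.smult_closed \<delta>x B)
    also have "\<dots> = (\<Oplus>\<^bsub>regular_module R\<^esub>b\<in>B. (f b \<odot>\<^bsub>dual_module R M\<^esub> \<delta> b) x)"
    proof (rule abelian_monoid.finsum_cong')
      show "abelian_monoid (regular_module R)"
        using reg by (simp add: module_def abelian_group_def)
      show "(\<lambda>b. (f b \<odot>\<^bsub>dual_module R M\<^esub> \<delta> b) x) \<in> B \<rightarrow> carrier (regular_module R)"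
        using summand dual_closed[OF _ x] by auto
      fix b assume "b \<in> B"
      then show "f (\<delta> b x \<odot>\<^bsub>M\<^esub> b) = (f b \<odot>\<^bsub>dual_module R M\<^esub> \<delta> b) x"
        using B \<delta>x x module_hom_smult[OF dual_hom[OF f]] dual_closed[OF f]
        by (simp add: dual_module_simps(4) M.R.m_comm)
    qed simp
    also have "\<dots> = (\<Oplus>\<^bsub>dual_module R M\<^esub>b\<in>B. f b \<odot>\<^bsub>dual_module R M\<^esub> \<delta> b) x"
      by (rule module_hom_finsum[OF D.module_axioms reg dual_eval_hom[OF M x] summand, symmetric])
    finally show "f x = (\<Oplus>\<^bsub>dual_module R M\<^esub>b\<in>B. f b \<odot>\<^bsub>dual_module R M\<^esub> \<delta> b) x" .
  qed
qed

text \<open>The left factor is arbitrary because the cube is bracketed to the left: the same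
  contraction serves with \<open>N\<close> the square of the dual and then with \<open>N\<close> the
  dual itself.\<close>

definition contract ::
    "('a, 'k) ring_scheme \<Rightarrow> ('a, 'c, 'n) module_scheme \<Rightarrow> ('a, 'b, 'm) module_scheme
      \<Rightarrow> 'b \<Rightarrow> ('c \<times> ('b \<Rightarrow> 'a) \<Rightarrow> 'a) set \<Rightarrow> 'c"
  where "contract R N M z = tensor_lift R N (dual_module R M) N (\<lambda>n f. f z \<odot>\<^bsub>N\<^esub> n)"

context
  fixes R :: "('a, 'k) ring_scheme"
    and M :: "('a, 'b, 'm) module_scheme" and N :: "('a, 'c, 'n) module_scheme"
  assumes M: "module R M" and N: "module R N"
begin

interpretation N: module R N by (rule N)

lemma contract_bilinear:
  assumes z: "z \<in> carrier M"
  shows "bilinear_map R N (dual_module R M) N (\<lambda>n f. f z \<odot>\<^bsub>N\<^esub> n)"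
  unfolding bilinear_map_def
proof (intro conjI ballI)
  fix n assume n: "n \<in> carrier N"
  show "(\<lambda>f. f z \<odot>\<^bsub>N\<^esub> n) \<in> module_hom R (dual_module R M) N"
    by (rule module_hom_smult_const[OF N dual_eval_hom[OF M z] n])
next
  fix f assume f: "f \<in> carrier (dual_module R M)"
  show "(\<lambda>n. f z \<odot>\<^bsub>N\<^esub> n) \<in> module_hom R N N"
    using module_hom_pointwise_smult[OF N module_hom_id dual_closed[OF f z]] by simp
qed

lemmas contract_hom = tensor_lift_hom[OF N dual_module_module[OF M] N contract_bilinear, folded contract_def]
lemmas contract_tensor = tensor_lift_tensor[OF N dual_module_module[OF M] N contract_bilinear, folded contract_def]

text \<open>On a pure tensor of \<open>n\<close> and \<open>f\<close>, expand \<open>f\<close> along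
  the forms \<open>\<delta> b\<close> and move each scalar \<open>f b\<close> across to
  \<open>n\<close>; the left factor is then the contraction with \<open>b\<close>.\<close>

lemma contract_expansion:
  assumes basis: "dual_basis R M B \<delta>" and t: "t \<in> carrier (tensor_product R N (dual_module R M))"
  shows "t = (\<Oplus>\<^bsub>tensor_product R N (dual_module R M)\<^esub>b\<in>B.
    tensor R N (dual_module R M) (contract R N M b t) (\<delta> b))"
proof -
  note D = dual_module_module[OF M]
  note T = tensor_product_module[OF N D]
  interpret D: module R "dual_module R M" by (rule D)
  interpret T: module R "tensor_product R N (dual_module R M)" by (rule T)
  note B = dual_basisD(1)[OF basis] and \<delta> = dual_basisD(2)[OF basis]
  have hom: "(\<lambda>t. \<Oplus>\<^bsub>tensor_product R N (dual_module R M)\<^esub>b\<in>B. tensor R N (dual_module R M) (contract R N M b t) (\<delta> b))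
      \<in> module_hom R (tensor_product R N (dual_module R M)) (tensor_product R N (dual_module R M))"
    by (rule module_hom_finsum_maps[OF T T module_hom_compose[OF contract_hom[OF B] tensor_hom_left[OF N D \<delta>]]])
  \<comment> \<open>The left side is written with \<open>id\<close> so that both sides are linear
    maps applied to \<open>t\<close>.\<close>
  have "id t = (\<Oplus>\<^bsub>tensor_product R N (dual_module R M)\<^esub>b\<in>B. tensor R N (dual_module R M) (contract R N M b t) (\<delta> b))"
  proof (rule tensor_hom_eqI[OF N D T module_hom_id hom _ t])
    fix n f assume n: "n \<in> carrier N" and f: "f \<in> carrier (dual_module R M)"
    have fb: "f b \<in> carrier R" if "b \<in> B" for b using dual_closed[OF f B[OF that]] .
    have "id (tensor R N (dual_module R M) n f)
        = tensor R N (dual_module R M) n (\<Oplus>\<^bsub>dual_module R M\<^esub>b\<in>B. f b \<odot>\<^bsub>dual_module R M\<^esub> \<delta> b)"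
      unfolding id_apply by (rule arg_cong[OF dual_expansion[OF M basis f]])
    also have "\<dots> = (\<Oplus>\<^bsub>tensor_product R N (dual_module R M)\<^esub>b\<in>B.
        tensor R N (dual_module R M) n (f b \<odot>\<^bsub>dual_module R M\<^esub> \<delta> b))"
      by (rule module_hom_finsum[OF D T tensor_hom_right[OF N D n]]) (auto intro!: D.smult_closed fb \<delta>)
    also have "\<dots> = (\<Oplus>\<^bsub>tensor_product R N (dual_module R M)\<^esub>b\<in>B.
        tensor R N (dual_module R M) (contract R N M b (tensor R N (dual_module R M) n f)) (\<delta> b))"
    proof (rule T.M.finsum_cong'[OF refl])
      show "(\<lambda>b. tensor R N (dual_module R M) (contract R N M b (tensor R N (dual_module R M) n f)) (\<delta> b))
          \<in> B \<rightarrow> carrier (tensor_product R N (dual_module R M))"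
        by (intro funcsetI tensor_closed[OF N D] module_hom_closedD[OF contract_hom] B n f \<delta>)
    next
      fix b assume b: "b \<in> B"
      show "tensor R N (dual_module R M) n (f b \<odot>\<^bsub>dual_module R M\<^esub> \<delta> b)
          = tensor R N (dual_module R M) (contract R N M b (tensor R N (dual_module R M) n f)) (\<delta> b)"
        unfolding contract_tensor[OF B[OF b] n f]
          module_hom_smult[OF tensor_hom_right[OF N D n] fb[OF b] \<delta>[OF b]]
          module_hom_smult[OF tensor_hom_left[OF N D \<delta>[OF b]] fb[OF b] n] ..
    qed
    finally show "id (tensor R N (dual_module R M) n f) = (\<Oplus>\<^bsub>tensor_product R N (dual_module R M)\<^esub>b\<in>B.
        tensor R N (dual_module R M) (contract R N M b (tensor R N (dual_module R M) n f)) (\<delta> b))" .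
  qed
  then show ?thesis by simp
qed

text \<open>The contractions with the members of \<open>B\<close> already rebuild the
  tensor.\<close>

lemma contract_eqI:
  assumes basis: "dual_basis R M B \<delta>"
    and t: "t \<in> carrier (tensor_product R N (dual_module R M))"
    and u: "u \<in> carrier (tensor_product R N (dual_module R M))"
    and eq: "\<And>z. z \<in> carrier M \<Longrightarrow> contract R N M z t = contract R N M z u"
  shows "t = u"
proof -
  interpret T: module R "tensor_product R N (dual_module R M)"
    by (rule tensor_product_module[OF N dual_module_module[OF M]])
  note B = dual_basisD(1)[OF basis] and \<delta> = dual_basisD(2)[OF basis]
  have "t = (\<Oplus>\<^bsub>tensor_product R N (dual_module R M)\<^esub>b\<in>B.
      tensor R N (dual_module R M) (contract R N M b t) (\<delta> b))"
    by (rule contract_expansion[OF basis t])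
  also have "\<dots> = (\<Oplus>\<^bsub>tensor_product R N (dual_module R M)\<^esub>b\<in>B.
      tensor R N (dual_module R M) (contract R N M b u) (\<delta> b))"
  proof (rule T.M.finsum_cong'[OF refl])
    show "(\<lambda>b. tensor R N (dual_module R M) (contract R N M b u) (\<delta> b))
        \<in> B \<rightarrow> carrier (tensor_product R N (dual_module R M))"
      by (intro funcsetI tensor_closed[OF N dual_module_module[OF M]] module_hom_closedD[OF contract_hom] B u \<delta>)
  qed (simp only: eq[OF B])
  also have "\<dots> = u"
    by (rule contract_expansion[OF basis u, symmetric])
  finally show ?thesis .
qed

end


section \<open>The comultiplication dual to a multiplication\<close>

context
  fixes R :: "('a, 'k) ring_scheme" and M :: "('a, 'b, 'm) module_scheme"
  assumes M: "module R M"
begin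

interpretation M: module R M by (rule M)

private abbreviation (input) "M_dual \<equiv> dual_module R M"

private lemmas module_facts =
  dual_module_module[OF M] ring_module[OF M] tensor_product_module[OF M M]
  dual_module_module[OF tensor_product_module[OF M M]]
  tensor_product_module[OF dual_module_module[OF M] dual_module_module[OF M]]

lemma dual_product_bilinear:
  assumes f: "f \<in> carrier M_dual" and g: "g \<in> carrier M_dual"
  shows "bilinear_map R M M (regular_module R) (\<lambda>x y. f x \<otimes>\<^bsub>R\<^esub> g y)"
  unfolding bilinear_map_def
proof (intro conjI ballI)
  fix x assume x: "x \<in> carrier M"
  show "(\<lambda>y. f x \<otimes>\<^bsub>R\<^esub> g y) \<in> module_hom R M (regular_module R)"
    using module_hom_pointwise_smult[OF module_facts(2) dual_hom[OF g] dual_closed[OF f x]]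
    unfolding regular_module_simps .
next
  fix y assume y: "y \<in> carrier M"
  have "g y \<in> carrier (regular_module R)"
    using dual_closed[OF g y] by simp
  from module_hom_smult_const[OF module_facts(2) dual_hom[OF f] this]
  show "(\<lambda>x. f x \<otimes>\<^bsub>R\<^esub> g y) \<in> module_hom R M (regular_module R)"
    unfolding regular_module_simps .
qed

text \<open>Besides linearity, membership in a dual demands extensionality; this is where that
  property of \<open>tensor_lift\<close> enters.\<close>

lemma dual_product_closed:
  assumes "f \<in> carrier M_dual" and "g \<in> carrier M_dual"
  shows "tensor_lift R M M (regular_module R) (\<lambda>x y. f x \<otimes>\<^bsub>R\<^esub> g y) \<in> carrier (dual_module R (tensor_product R M M))"
  unfolding dual_module_simps
  by (intro IntI tensor_lift_hom tensor_lift_extensional dual_product_bilinear assms M module_facts)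

text \<open>Linearity in each form is tested at a tensor \<open>w\<close>, and from there on pure
  tensors, where the value is a product of scalars.\<close>

lemma dual_tensor_bilinear:
  "bilinear_map R M_dual M_dual (dual_module R (tensor_product R M M))
    (\<lambda>f g. tensor_lift R M M (regular_module R) (\<lambda>x y. f x \<otimes>\<^bsub>R\<^esub> g y))"
  unfolding bilinear_map_def
proof (intro conjI ballI)
  fix f assume f: "f \<in> carrier M_dual"
  show "(\<lambda>g. tensor_lift R M M (regular_module R) (\<lambda>x y. f x \<otimes>\<^bsub>R\<^esub> g y))
      \<in> module_hom R M_dual (dual_module R (tensor_product R M M))"
  proof (rule dual_valued_homI[OF module_facts(3) dual_product_closed[OF f] module_facts(1)])
    fix w assume w: "w \<in> carrier (tensor_product R M M)"
    show "(\<lambda>g. tensor_lift R M M (regular_module R) (\<lambda>x y. f x \<otimes>\<^bsub>R\<^esub> g y) w) \<in> module_hom R M_dual (regular_module R)"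
    proof (rule tensor_lift_family_hom[OF M M module_facts(1,2) dual_product_bilinear[OF f] _ w])
      fix x y assume x: "x \<in> carrier M" and y: "y \<in> carrier M"
      show "(\<lambda>g. f x \<otimes>\<^bsub>R\<^esub> g y) \<in> module_hom R M_dual (regular_module R)"
        using module_hom_pointwise_smult[OF module_facts(2) dual_eval_hom[OF M y] dual_closed[OF f x]]
        unfolding regular_module_simps .
    qed
  qed
next
  fix g assume g: "g \<in> carrier M_dual"
  show "(\<lambda>f. tensor_lift R M M (regular_module R) (\<lambda>x y. f x \<otimes>\<^bsub>R\<^esub> g y))
      \<in> module_hom R M_dual (dual_module R (tensor_product R M M))"
  proof (rule dual_valued_homI[OF module_facts(3) dual_product_closed[OF _ g] module_facts(1)])
    fix w assume w: "w \<in> carrier (tensor_product R M M)"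
    show "(\<lambda>f. tensor_lift R M M (regular_module R) (\<lambda>x y. f x \<otimes>\<^bsub>R\<^esub> g y) w) \<in> module_hom R M_dual (regular_module R)"
    proof (rule tensor_lift_family_hom[OF M M module_facts(1,2) dual_product_bilinear[OF _ g] _ w])
      fix x y assume x: "x \<in> carrier M" and y: "y \<in> carrier M"
      have "g y \<in> carrier (regular_module R)"
        using dual_closed[OF g y] by simp
      from module_hom_smult_const[OF module_facts(2) dual_eval_hom[OF M x] this]
      show "(\<lambda>f. f x \<otimes>\<^bsub>R\<^esub> g y) \<in> module_hom R M_dual (regular_module R)"
        unfolding regular_module_simps .
    qed
  qed
qed

lemmas dual_tensor_map_hom =
  tensor_lift_hom[OF module_facts(1,1,4) dual_tensor_bilinear, folded dual_tensor_map_def]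

lemma dual_tensor_map_tensor:
  assumes f: "f \<in> carrier M_dual" and g: "g \<in> carrier M_dual" and x: "x \<in> carrier M" and y: "y \<in> carrier M"
  shows "dual_tensor_map R M (tensor R M_dual M_dual f g) (tensor R M M x y) = f x \<otimes>\<^bsub>R\<^esub> g y"
  unfolding dual_tensor_map_def tensor_lift_tensor[OF module_facts(1,1,4) dual_tensor_bilinear f g]
  by (rule tensor_lift_tensor[OF M M module_facts(2) dual_product_bilinear[OF f g] x y])

text \<open>Translates the canonical map into contractions. On pure tensors the two sides are the
  products of \<open>f x\<close> and \<open>g y\<close> in opposite orders.\<close>

lemma dual_tensor_map_contract:
  assumes x: "x \<in> carrier M" and y: "y \<in> carrier M" and t: "t \<in> carrier (tensor_product R M_dual M_dual)"
  shows "dual_tensor_map R M t (tensor R M M x y) = contract R M_dual M y t x"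
proof (rule tensor_hom_eqI[OF module_facts(1,1,2)
      module_hom_compose[OF dual_tensor_map_hom dual_eval_hom[OF module_facts(3) tensor_closed[OF M M x y]]]
      module_hom_compose[OF contract_hom[OF M module_facts(1) y] dual_eval_hom[OF M x]] _ t])
  fix f g assume f: "f \<in> carrier M_dual" and g: "g \<in> carrier M_dual"
  show "dual_tensor_map R M (tensor R M_dual M_dual f g) (tensor R M M x y) = contract R M_dual M y (tensor R M_dual M_dual f g) x"
    unfolding dual_tensor_map_tensor[OF f g x y] contract_tensor[OF M module_facts(1) y f g] dual_module_simps
      restrict_apply'[OF x]
    by (rule M.R.m_comm[OF dual_closed[OF f x] dual_closed[OF g y]])
qed

lemma dual_tensor_map_inj:
  assumes basis: "dual_basis R M B \<delta>"
  shows "inj_on (dual_tensor_map R M) (carrier (tensor_product R M_dual M_dual))"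
proof (rule inj_onI)
  fix t u assume t: "t \<in> carrier (tensor_product R M_dual M_dual)" and u: "u \<in> carrier (tensor_product R M_dual M_dual)"
    and eq: "dual_tensor_map R M t = dual_tensor_map R M u"
  show "t = u"
  proof (rule contract_eqI[OF M module_facts(1) basis t u])
    fix y assume y: "y \<in> carrier M"
    note closed = module_hom_closedD[OF contract_hom[OF M module_facts(1) y]]
    show "contract R M_dual M y t = contract R M_dual M y u"
    proof (rule dual_eqI[OF closed[OF t] closed[OF u]])
      fix x assume x: "x \<in> carrier M"
      show "contract R M_dual M y t x = contract R M_dual M y u x"
        using dual_tensor_map_contract[OF x y t] dual_tensor_map_contract[OF x y u] eq by (simp only:)
    qed
  qed
qed

lemma dual_tensor_map_surj:
  assumes basis: "dual_basis R M B \<delta>" and p: "p \<in> carrier (dual_module R (tensor_product R M M))"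
  shows "p \<in> dual_tensor_map R M ` carrier (tensor_product R M_dual M_dual)"
proof -
  note B = dual_basisD(1)[OF basis] and \<delta> = dual_basisD(2)[OF basis] and expand = dual_basisD(3)[OF basis]
  interpret D: module R M_dual by (rule module_facts(1))
  interpret T: module R "tensor_product R M_dual M_dual" by (rule module_facts(5))
  \<comment> \<open>The preimage of \<open>p\<close> is forced by the expansion of the second
    argument: the form \<open>p\<close> restricted to tensors with last factor \<open>c\<close> is
    paired with \<open>\<delta> c\<close>, and summing over \<open>c\<close> recovers
    \<open>p\<close> because \<open>y\<close> is the sum of the multiples
    \<open>\<delta> c y\<close> of \<open>c\<close>.\<close>
  define q where "q c = (\<lambda>x\<in>carrier M. p (tensor R M M x c))" for c
  have q: "q c \<in> carrier M_dual" if "c \<in> B" for c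
    unfolding q_def
    by (rule dual_restrictI[OF M module_hom_compose[OF tensor_hom_left[OF M M B[OF that]] dual_hom[OF p]]])
  define t where "t = (\<Oplus>\<^bsub>tensor_product R M_dual M_dual\<^esub>c\<in>B. tensor R M_dual M_dual (q c) (\<delta> c))"
  have summand: "(\<lambda>c. tensor R M_dual M_dual (q c) (\<delta> c)) \<in> B \<rightarrow> carrier (tensor_product R M_dual M_dual)"
    by (intro funcsetI tensor_closed[OF module_facts(1,1)] q \<delta>)
  have t: "t \<in> carrier (tensor_product R M_dual M_dual)"
    unfolding t_def by (rule T.M.finsum_closed[OF summand])
  have pure: "dual_tensor_map R M t (tensor R M M x y) = p (tensor R M M x y)"
    if x: "x \<in> carrier M" and y: "y \<in> carrier M" for x y
  proof -
    have xy: "tensor R M M x y \<in> carrier (tensor_product R M M)"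
      by (rule tensor_closed[OF M M x y])
    have \<delta>y: "\<delta> c y \<in> carrier R" if "c \<in> B" for c
      by (rule dual_closed[OF \<delta>[OF that] y])
    have scaled: "(\<lambda>c. \<delta> c y \<odot>\<^bsub>M\<^esub> c) \<in> B \<rightarrow> carrier M"
      by (intro funcsetI M.smult_closed \<delta>y B)
    \<comment> \<open>Sums of scalars are formed in \<open>regular_module R\<close>, since that is
      the target module of the linear maps moved past them.\<close>
    have "abelian_monoid (regular_module R)"
      using module_facts(2) by (simp add: module_def abelian_group_def)
    note cong = abelian_monoid.finsum_cong'[OF this refl]
    have right: "(\<lambda>z. p (tensor R M M x z)) \<in> module_hom R M (regular_module R)"
      by (rule module_hom_compose[OF tensor_hom_right[OF M M x] dual_hom[OF p]])
    have "dual_tensor_map R M t (tensor R M M x y)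
        = (\<Oplus>\<^bsub>regular_module R\<^esub>c\<in>B. dual_tensor_map R M (tensor R M_dual M_dual (q c) (\<delta> c)) (tensor R M M x y))"
      unfolding t_def
      by (rule module_hom_finsum[OF module_facts(5,2)
            module_hom_compose[OF dual_tensor_map_hom dual_eval_hom[OF module_facts(3) xy]] summand])
    also have "\<dots> = (\<Oplus>\<^bsub>regular_module R\<^esub>c\<in>B. p (tensor R M M x (\<delta> c y \<odot>\<^bsub>M\<^esub> c)))"
    proof (rule cong)
      show "(\<lambda>c. p (tensor R M M x (\<delta> c y \<odot>\<^bsub>M\<^esub> c))) \<in> B \<rightarrow> carrier (regular_module R)"
        by (intro funcsetI module_hom_closedD[OF right] M.smult_closed \<delta>y B)
    next
      fix c assume c: "c \<in> B"
      have qx: "q c x = p (tensor R M M x c)"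
        using x by (simp add: q_def)
      show "dual_tensor_map R M (tensor R M_dual M_dual (q c) (\<delta> c)) (tensor R M M x y) = p (tensor R M M x (\<delta> c y \<odot>\<^bsub>M\<^esub> c))"
        unfolding dual_tensor_map_tensor[OF q[OF c] \<delta>[OF c] x y] module_hom_smult[OF right \<delta>y[OF c] B[OF c]]
          regular_module_simps qx[symmetric]
        by (rule M.R.m_comm[OF dual_closed[OF q[OF c] x] \<delta>y[OF c]])
    qed
    also have "\<dots> = p (tensor R M M x (\<Oplus>\<^bsub>M\<^esub>c\<in>B. \<delta> c y \<odot>\<^bsub>M\<^esub> c))"
      by (rule module_hom_finsum[OF M module_facts(2) right scaled, symmetric])
    also have "\<dots> = p (tensor R M M x y)"
      by (rule arg_cong[OF expand[OF y, symmetric], of "\<lambda>z. p (tensor R M M x z)"])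
    finally show ?thesis .
  qed
  have map_t: "dual_tensor_map R M t \<in> carrier (dual_module R (tensor_product R M M))"
    by (rule module_hom_closedD[OF dual_tensor_map_hom t])
  have "dual_tensor_map R M t = p"
    by (rule dual_eqI[OF map_t p], rule tensor_hom_eqI[OF M M module_facts(2) dual_hom[OF map_t] dual_hom[OF p] pure])
  then show ?thesis
    by (rule rev_image_eqI[OF t sym])
qed

lemma dual_tensor_map_bij:
  assumes "dual_basis R M B \<delta>"
  shows "bij_betw (dual_tensor_map R M) (carrier (tensor_product R M_dual M_dual))
    (carrier (dual_module R (tensor_product R M M)))"
  unfolding bij_betw_def
  by (intro conjI equalityI subsetI dual_tensor_map_inj[OF assms] dual_tensor_map_surj[OF assms])
    (blast intro: module_hom_closedD[OF dual_tensor_map_hom])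

section \<open>The transpose of a multiplication\<close>

context
  fixes B \<delta> \<mu>
  assumes basis: "dual_basis R M B \<delta>" and \<mu>: "\<mu> \<in> module_hom R (tensor_product R M M) M"
begin

lemma transpose_map_closed:
  "f \<in> carrier M_dual \<Longrightarrow> transpose_map (tensor_product R M M) \<mu> f \<in> carrier (dual_module R (tensor_product R M M))"
  unfolding transpose_map_def
  by (rule dual_restrictI[OF module_facts(3) module_hom_compose[OF \<mu> dual_hom]])

lemma transpose_map_hom:
  "transpose_map (tensor_product R M M) \<mu> \<in> module_hom R M_dual (dual_module R (tensor_product R M M))"
proof (rule dual_valued_homI[OF module_facts(3) transpose_map_closed module_facts(1)])
  fix w assume w: "w \<in> carrier (tensor_product R M M)"
  show "(\<lambda>f. transpose_map (tensor_product R M M) \<mu> f w) \<in> module_hom R M_dual (regular_module R)"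
    unfolding transpose_map_def restrict_apply'[OF w]
    by (rule dual_eval_hom[OF M module_hom_closedD[OF \<mu> w]])
qed

lemma dual_comult_hom: "dual_comult R M \<mu> \<in> module_hom R M_dual (tensor_product R M_dual M_dual)"
  using module_hom_compose[OF transpose_map_hom
      inv_into_module_hom[OF module_facts(5) dual_tensor_map_hom dual_tensor_map_bij[OF basis]]]
  by (simp only: dual_comult_def[symmetric])

text \<open>The working description of \<Delta>. Bijectivity of the canonical map makes it undo
  \<open>inv_into\<close>, which leaves the transpose of \<mu> evaluated at a pure tensor.\<close>

lemma contract_comult:
  assumes f: "f \<in> carrier M_dual" and x: "x \<in> carrier M" and y: "y \<in> carrier M"
  shows "contract R M_dual M y (dual_comult R M \<mu> f) x = f (\<mu> (tensor R M M x y))"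
proof -
  have "dual_tensor_map R M (dual_comult R M \<mu> f) = transpose_map (tensor_product R M M) \<mu> f"
    unfolding dual_comult_def
    by (rule bij_betw_inv_into_right[OF dual_tensor_map_bij[OF basis] transpose_map_closed[OF f]])
  then show ?thesis
    unfolding dual_tensor_map_contract[OF x y module_hom_closedD[OF dual_comult_hom f], symmetric]
    by (simp only: transpose_map_def restrict_apply'[OF tensor_closed[OF M M x y]])
qed

end

end

section \<open>The action of the symmetric group on the third tensor power\<close>

lemma permutes_3_cases:
  assumes "p permutes {1, 2, 3::nat}"
  obtains "p 1 = 1" "p 2 = 2" "p 3 = 3" | "p 1 = 1" "p 2 = 3" "p 3 = 2"
    | "p 1 = 2" "p 2 = 1" "p 3 = 3" | "p 1 = 2" "p 2 = 3" "p 3 = 1"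
    | "p 1 = 3" "p 2 = 1" "p 3 = 2" | "p 1 = 3" "p 2 = 2" "p 3 = 1"
proof -
  have "p 1 \<in> {1, 2, 3}" "p 2 \<in> {1, 2, 3}" "p 3 \<in> {1, 2, 3}"
    using permutes_in_image[OF assms] by blast+
  moreover have "p 1 \<noteq> p 2" "p 1 \<noteq> p 3" "p 2 \<noteq> p 3"
    using permutes_inj[OF assms] by (auto simp: inj_eq)
  ultimately show ?thesis
    using that by auto
qed

text \<open>Triples are handled as functions on positions, so that permuting them is composition;
  only the values at 1, 2 and 3 are controlled.\<close>

lemma permutes_3_point:
  assumes "p permutes {1, 2, 3::nat}" and "x 1 \<in> S" and "x 2 \<in> S" and "x 3 \<in> S"
  shows "x (p 1) \<in> S" and "x (p 2) \<in> S" and "x (p 3) \<in> S"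
proof -
  have "x (p 1) \<in> S \<and> x (p 2) \<in> S \<and> x (p 3) \<in> S"
    using assms(1) by (cases rule: permutes_3_cases) (simp_all only: assms(2-4) simp_thms)
  then show "x (p 1) \<in> S" and "x (p 2) \<in> S" and "x (p 3) \<in> S"
    by blast+
qed

context
  fixes R :: "('a, 'k) ring_scheme" and N :: "('a, 'b, 'm) module_scheme"
  assumes N: "module R N"
begin

lemma perm_map_trilinear:
  assumes "\<sigma> permutes {1, 2, 3}"
  shows "trilinear_map R N (tensor_cube R N)
    (\<lambda>x\<^sub>1 x\<^sub>2 x\<^sub>3. let x = (\<lambda>k. [x\<^sub>1, x\<^sub>2, x\<^sub>3] ! (k - 1)); \<tau> = inv_into UNIV \<sigma>
       in tensor_triple R N (x (\<tau> 1)) (x (\<tau> 2)) (x (\<tau> 3)))"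
proof -
  note t = tensor_triple_trilinear[OF N]
  \<comment> \<open>Linearity in the third, second and first argument. Each of the six arrangements
    below needs all three, in its own order.\<close>
  note hom = trilinear_mapD(1)[OF t] bilinear_mapD(2)[OF trilinear_mapD(2)[OF t]] trilinear_mapD(3)[OF t]
  have "trilinear_map R N (tensor_cube R N) (\<lambda>x y z. tensor_triple R N x y z)"
    and "trilinear_map R N (tensor_cube R N) (\<lambda>x y z. tensor_triple R N x z y)"
    and "trilinear_map R N (tensor_cube R N) (\<lambda>x y z. tensor_triple R N y x z)"
    and "trilinear_map R N (tensor_cube R N) (\<lambda>x y z. tensor_triple R N y z x)"
    and "trilinear_map R N (tensor_cube R N) (\<lambda>x y z. tensor_triple R N z x y)"
    and "trilinear_map R N (tensor_cube R N) (\<lambda>x y z. tensor_triple R N z y x)"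
    unfolding trilinear_map_def bilinear_map_def by (intro conjI ballI hom; assumption)+
  note permuted = this
  show ?thesis
    using permutes_inv[OF assms] by (cases rule: permutes_3_cases) (simp_all add: Let_def permuted)
qed

lemmas perm_map_hom =
  tensor_cube_lift_hom[OF N tensor_cube_module[OF N] perm_map_trilinear, folded perm_map_def]

text \<open>Replaces the list lookup of the definition by an arbitrary function on positions, the
  form that composes with further permutations.\<close>

lemma perm_map_triple:
  assumes \<sigma>: "\<sigma> permutes {1, 2, 3}" and x: "x 1 \<in> carrier N" "x 2 \<in> carrier N" "x 3 \<in> carrier N"
  shows "perm_map R N \<sigma> (tensor_triple R N (x 1) (x 2) (x 3)) =
    tensor_triple R N (x (inv_into UNIV \<sigma> 1)) (x (inv_into UNIV \<sigma> 2)) (x (inv_into UNIV \<sigma> 3))"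
proof -
  note perm = tensor_cube_lift_triple[OF N tensor_cube_module[OF N] perm_map_trilinear[OF \<sigma>] x, folded perm_map_def]
  show ?thesis
    unfolding perm using permutes_inv[OF \<sigma>]
    by (cases rule: permutes_3_cases) (simp_all add: Let_def)
qed

end

lemma sign_inv:
  assumes "\<sigma> permutes S" and "finite S"
  shows "sign (inv_into UNIV \<sigma>) = sign \<sigma>"
  using assms by (intro sign_inverse) (auto simp: permutation_permutes)

lemma inv_3_cycle:
  "inv_into UNIV (cycle_of_list [1, 2, 3::nat]) = cycle_of_list [1, 3, 2]"
  "inv_into UNIV (cycle_of_list [1, 3, 2::nat]) = cycle_of_list [1, 2, 3]"
proof -
  have "cycle_of_list [1, 2, 3::nat] \<circ> cycle_of_list [1, 3, 2] = id"
    and "cycle_of_list [1, 3, 2::nat] \<circ> cycle_of_list [1, 2, 3] = id"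
    by (auto simp: fun_eq_iff transpose_def)
  then show "inv_into UNIV (cycle_of_list [1, 2, 3::nat]) = cycle_of_list [1, 3, 2]"
    and "inv_into UNIV (cycle_of_list [1, 3, 2::nat]) = cycle_of_list [1, 2, 3]"
    by (auto intro: inv_unique_comp)
qed

lemma sigma3_subgroup:
  assumes "i \<in> {1..6}"
  shows sigma3_subgroup_permutes: "\<sigma> \<in> sigma3_subgroup i \<Longrightarrow> \<sigma> permutes {1, 2, 3}"
    and sigma3_subgroup_inv: "\<sigma> \<in> sigma3_subgroup i \<Longrightarrow> inv_into UNIV \<sigma> \<in> sigma3_subgroup i"
proof -
  \<comment> \<open>Here the cycles are unfolded into transpositions. In the case analyses below
    they stay folded, so that this fact and \<open>inv_3_cycle\<close> match.\<close>
  have cycles: "cycle_of_list [1, 2, 3::nat] permutes {1, 2, 3}" "cycle_of_list [1, 3, 2::nat] permutes {1, 2, 3}"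
    by (auto intro!: permutes_compose permutes_swap_id)
  have "i = 1 \<or> i = 2 \<or> i = 3 \<or> i = 4 \<or> i = 5 \<or> i = 6"
    using assms by auto
  then show "\<sigma> \<in> sigma3_subgroup i \<Longrightarrow> \<sigma> permutes {1, 2, 3}"
    using cycles
    by (elim disjE) (auto simp: sigma3_subgroup_def permutes_id permutes_swap_id simp del: cycle_of_list.simps)
  from \<open>i = 1 \<or> i = 2 \<or> i = 3 \<or> i = 4 \<or> i = 5 \<or> i = 6\<close>
  show "\<sigma> \<in> sigma3_subgroup i \<Longrightarrow> inv_into UNIV \<sigma> \<in> sigma3_subgroup i"
    by (elim disjE) (auto simp: sigma3_subgroup_def inv_3_cycle permutes_inv inv_transpose_eq simp del: cycle_of_list.simps One_nat_def)
qed


section \<open>Evaluation of tensors of linear forms\<close>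

text \<open>The trilinear form on \<open>M\<close> that \<open>t\<close> represents. The left
  bracketing dictates the order: the last argument is consumed first, and the remaining form is
  evaluated at \<open>x\<close>.\<close>

definition cube_eval ::
    "('a, 'k) ring_scheme \<Rightarrow> ('a, 'b, 'm) module_scheme \<Rightarrow> 'b \<Rightarrow> 'b \<Rightarrow> 'b
      \<Rightarrow> ('a, 'b \<Rightarrow> 'a) tensor3 \<Rightarrow> 'a"
  where "cube_eval R M x y z t =
    contract R (dual_module R M) M y
      (contract R (tensor_product R (dual_module R M) (dual_module R M)) M z t) x"

section \<open>The associator and evaluation on pure tensors\<close>

lemma associator_hom:
  assumes M: "module R M" and \<mu>: "\<mu> \<in> module_hom R (tensor_product R M M) M"
  shows "associator R M \<mu> \<in> module_hom R (tensor_cube R M) M"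
proof -
  note MM = square_module[OF M]
  have "(\<lambda>t. \<mu> (tensor_map R (tensor_product R M M) M M M \<mu> id t)) \<in> module_hom R (tensor_cube R M) M"
    unfolding tensor_cube_def
    by (rule module_hom_compose[OF tensor_map_hom[OF MM M M M \<mu> module_hom_id] \<mu>])
  moreover have "(\<lambda>t. \<mu> (tensor_map R M (tensor_product R M M) M M id \<mu> (tensor_assoc R M t))) \<in> module_hom R (tensor_cube R M) M"
    by (rule module_hom_compose[OF tensor_assoc_hom[OF M]
          module_hom_compose[OF tensor_map_hom[OF M MM M M module_hom_id \<mu>] \<mu>]])
  ultimately show ?thesis
    unfolding associator_def by (rule module_hom_pointwise_diff[OF tensor_cube_module[OF M] M])
qed

lemma associator_triple:
  assumes M: "module R M" and \<mu>: "\<mu> \<in> module_hom R (tensor_product R M M) M"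
    and x: "x \<in> carrier M" and y: "y \<in> carrier M" and z: "z \<in> carrier M"
  shows "associator R M \<mu> (tensor_triple R M x y z) =
    \<mu> (tensor R M M (\<mu> (tensor R M M x y)) z) \<ominus>\<^bsub>M\<^esub> \<mu> (tensor R M M x (\<mu> (tensor R M M y z)))"
proof -
  note MM = square_module[OF M]
  show ?thesis
    unfolding associator_def tensor_assoc_triple[OF M x y z]
      tensor_map_tensor[OF M MM M M module_hom_id \<mu> x tensor_closed[OF M M y z]]
    \<comment> \<open>The triple is opened only now, because \<open>tensor_assoc_triple\<close>
      matches it in folded form.\<close>
    unfolding tensor_triple_def tensor_map_tensor[OF MM M M M \<mu> module_hom_id tensor_closed[OF M M x y] z]
    unfolding id_apply ..
qed

context
  fixes R :: "('a, 'k) ring_scheme" and M :: "('a, 'b, 'm) module_scheme"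
  assumes M: "module R M"
begin

interpretation M: module R M by (rule M)

private abbreviation (input) "D \<equiv> dual_module R M"
private abbreviation (input) "DD \<equiv> tensor_product R D D"

private lemmas D = dual_module_module[OF M]
private lemmas DD = square_module[OF D]
private lemmas reg = ring_module[OF M]
private lemmas cube = tensor_cube_module[OF D]
private lemmas contract_D_hom = contract_hom[OF M D]
private lemmas contract_DD_hom = contract_hom[OF M DD, folded tensor_cube_def]

interpretation D: module R D by (rule D)

lemma contract_triple:
  assumes f: "f \<in> carrier D" and g: "g \<in> carrier D" and h: "h \<in> carrier D"
    and y: "y \<in> carrier M" and z: "z \<in> carrier M"
  shows "contract R D M y (contract R DD M z (tensor_triple R D f g h))
    = h z \<odot>\<^bsub>D\<^esub> (g y \<odot>\<^bsub>D\<^esub> f)"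
  unfolding tensor_triple_def contract_tensor[OF M DD z tensor_closed[OF D D f g] h]
    module_hom_smult[OF contract_D_hom[OF y] dual_closed[OF h z] tensor_closed[OF D D f g]]
    contract_tensor[OF M D y f g] ..

lemma cube_eval_hom:
  assumes "x \<in> carrier M" and "y \<in> carrier M" and "z \<in> carrier M"
  shows "cube_eval R M x y z \<in> module_hom R (tensor_cube R D) (regular_module R)"
  unfolding cube_eval_def
  by (rule module_hom_compose[OF contract_DD_hom[OF assms(3)]
        module_hom_compose[OF contract_D_hom[OF assms(2)] dual_eval_hom[OF M assms(1)]]])

lemma cube_eval_triple:
  assumes f: "f \<in> carrier D" and g: "g \<in> carrier D" and h: "h \<in> carrier D"
    and x: "x \<in> carrier M" and y: "y \<in> carrier M" and z: "z \<in> carrier M"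
  shows "cube_eval R M x y z (tensor_triple R D f g h) = h z \<otimes>\<^bsub>R\<^esub> (g y \<otimes>\<^bsub>R\<^esub> f x)"
  unfolding cube_eval_def contract_triple[OF f g h y z] dual_module_simps restrict_apply'[OF x] ..

lemma cube_eval_eqI:
  assumes basis: "dual_basis R M B \<delta>"
    and t: "t \<in> carrier (tensor_cube R D)" and u: "u \<in> carrier (tensor_cube R D)"
    and eq: "\<And>x y z. x \<in> carrier M \<Longrightarrow> y \<in> carrier M \<Longrightarrow> z \<in> carrier M \<Longrightarrow>
      cube_eval R M x y z t = cube_eval R M x y z u"
  shows "t = u"
proof (rule contract_eqI[OF M DD basis t[unfolded tensor_cube_def] u[unfolded tensor_cube_def]])
  fix z assume z: "z \<in> carrier M"
  note closed_z = module_hom_closedD[OF contract_DD_hom[OF z]]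
  show "contract R DD M z t = contract R DD M z u"
  proof (rule contract_eqI[OF M D basis closed_z[OF t] closed_z[OF u]])
    fix y assume y: "y \<in> carrier M"
    note closed_y = module_hom_closedD[OF contract_D_hom[OF y]]
    show "contract R D M y (contract R DD M z t) = contract R D M y (contract R DD M z u)"
      by (rule dual_eqI[OF closed_y[OF closed_z[OF t]] closed_y[OF closed_z[OF u]]])
        (rule eq[OF _ y z, unfolded cube_eval_def])
  qed
qed

text \<open>After the action, position \<open>k\<close> carries the form with index
  \<open>inv_into UNIV \<sigma> k\<close>, evaluated at \<open>x k\<close>. Substituting
  \<open>\<sigma> j\<close> for \<open>k\<close> pairs the form with index \<open>j\<close> with
  \<open>x (\<sigma> j)\<close>; the factors are reordered by commutativity of
  \<open>R\<close>.\<close>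

lemma cube_eval_perm:
  fixes x :: "nat \<Rightarrow> 'b"
  assumes \<sigma>: "\<sigma> permutes {1, 2, 3}" and x: "x 1 \<in> carrier M" "x 2 \<in> carrier M" "x 3 \<in> carrier M"
    and t: "t \<in> carrier (tensor_cube R D)"
  shows "cube_eval R M (x 1) (x 2) (x 3) (perm_map R D \<sigma> t) = cube_eval R M (x (\<sigma> 1)) (x (\<sigma> 2)) (x (\<sigma> 3)) t"
proof -
  have x\<sigma>: "x (\<sigma> 1) \<in> carrier M" "x (\<sigma> 2) \<in> carrier M" "x (\<sigma> 3) \<in> carrier M"
    using permutes_3_point[where x = x, OF \<sigma> x] .
  show ?thesis
  proof (rule tensor_cube_hom_eqI[OF D reg module_hom_compose[OF perm_map_hom[OF D \<sigma>] cube_eval_hom[OF x]] cube_eval_hom[OF x\<sigma>] _ t])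
    fix f g h assume fgh: "f \<in> carrier D" "g \<in> carrier D" "h \<in> carrier D"
    \<comment> \<open>Forms are indexed by position like the vectors. Values of \<open>F\<close>
      away from 1, 2 and 3 are never reached, since \<sigma> and its inverse preserve these
      positions.\<close>
    define F where "F k = [f, g, h] ! (k - 1)" for k :: nat
    have F_eq: "F 1 = f" "F 2 = g" "F 3 = h"
      by (simp_all add: F_def)
    have F: "F 1 \<in> carrier D" "F 2 \<in> carrier D" "F 3 \<in> carrier D"
      unfolding F_eq by (fact fgh)+
    note F_inv = permutes_3_point[where x = F, OF permutes_inv[OF \<sigma>] F]
    have inverse: "inv_into UNIV \<sigma> (\<sigma> k) = k" for k
      using permutes_inverses(2)[OF \<sigma>] .
    note closed = dual_closed[OF F(1)] dual_closed[OF F(2)] dual_closed[OF F(3)]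
    have "cube_eval R M (x 1) (x 2) (x 3) (perm_map R D \<sigma> (tensor_triple R D (F 1) (F 2) (F 3)))
        = F (inv_into UNIV \<sigma> 3) (x 3) \<otimes>\<^bsub>R\<^esub> (F (inv_into UNIV \<sigma> 2) (x 2) \<otimes>\<^bsub>R\<^esub> F (inv_into UNIV \<sigma> 1) (x 1))"
      unfolding perm_map_triple[where x = F, OF D \<sigma> F] by (rule cube_eval_triple[OF F_inv x])
    also have "\<dots> = F 3 (x (\<sigma> 3)) \<otimes>\<^bsub>R\<^esub> (F 2 (x (\<sigma> 2)) \<otimes>\<^bsub>R\<^esub> F 1 (x (\<sigma> 1)))"
      using \<sigma> inverse[of 1] inverse[of 2] inverse[of 3]
      by (cases rule: permutes_3_cases) (simp_all add: closed x M.R.m_ac del: One_nat_def)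
    also have "\<dots> = cube_eval R M (x (\<sigma> 1)) (x (\<sigma> 2)) (x (\<sigma> 3)) (tensor_triple R D (F 1) (F 2) (F 3))"
      by (rule cube_eval_triple[OF F x\<sigma>, symmetric])
    finally show "cube_eval R M (x 1) (x 2) (x 3) (perm_map R D \<sigma> (tensor_triple R D f g h))
        = cube_eval R M (x (\<sigma> 1)) (x (\<sigma> 2)) (x (\<sigma> 3)) (tensor_triple R D f g h)"
      unfolding F_eq .
  qed
qed

section \<open>Contractions and values of the coassociator\<close>

context
  fixes B \<delta> \<mu>
  assumes basis: "dual_basis R M B \<delta>" and \<mu>: "\<mu> \<in> module_hom R (tensor_product R M M) M"
begin

private abbreviation (input) "\<Delta> \<equiv> dual_comult R M \<mu>"

private lemmas comult_hom = dual_comult_hom[OF M basis \<mu>]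
private lemmas comult_closed = module_hom_closedD[OF comult_hom]
private lemmas left_hom = tensor_map_hom[OF D D DD D comult_hom module_hom_id, folded tensor_cube_def]
private lemmas right_hom = module_hom_compose[OF tensor_map_hom[OF D D D DD module_hom_id comult_hom] tensor_assoc_inv_hom[OF D]]

text \<open>Contraction with \<open>z\<close> acts on the right factor only and \<Delta> on the left
  one, so they commute; on pure tensors this is homogeneity of \<Delta>.\<close>

lemma contract_comult_left:
  assumes z: "z \<in> carrier M" and t: "t \<in> carrier DD"
  shows "contract R DD M z (tensor_map R D D DD D \<Delta> id t) = \<Delta> (contract R D M z t)"
proof (rule tensor_hom_eqI[OF D D DD module_hom_compose[OF left_hom contract_DD_hom[OF z]]
      module_hom_compose[OF contract_D_hom[OF z] comult_hom] _ t])
  fix f g assume f: "f \<in> carrier D" and g: "g \<in> carrier D"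
  show "contract R DD M z (tensor_map R D D DD D \<Delta> id (tensor R D D f g)) = \<Delta> (contract R D M z (tensor R D D f g))"
    unfolding tensor_map_tensor[OF D D DD D comult_hom module_hom_id f g]
    unfolding id_apply contract_tensor[OF M D z f g] contract_tensor[OF M DD z comult_closed[OF f] g]
      module_hom_smult[OF comult_hom dual_closed[OF g z] f] ..
qed

text \<open>After rebracketing, the last two factors come from \<open>u\<close>, so both
  contractions are spent on \<open>u\<close> and leave a multiple of \<open>f\<close>. The tensor
  \<open>u\<close> is arbitrary, because it will be a value of \<Delta>, which need not be
  pure.\<close>

lemma contract_assoc_inv:
  assumes f: "f \<in> carrier D" and u: "u \<in> carrier DD" and y: "y \<in> carrier M" and z: "z \<in> carrier M"
  shows "contract R D M y (contract R DD M z (tensor_assoc_inv R D (tensor R D DD f u)))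
    = contract R D M z u y \<odot>\<^bsub>D\<^esub> f"
proof (rule tensor_hom_eqI[OF D D D
      module_hom_compose[OF module_hom_compose[OF tensor_hom_right[OF D DD f] tensor_assoc_inv_hom[OF D]]
        module_hom_compose[OF contract_DD_hom[OF z] contract_D_hom[OF y]]]
      module_hom_smult_const[OF D module_hom_compose[OF contract_D_hom[OF z] dual_eval_hom[OF M y]] f] _ u])
  fix g h assume g: "g \<in> carrier D" and h: "h \<in> carrier D"
  show "contract R D M y (contract R DD M z (tensor_assoc_inv R D (tensor R D DD f (tensor R D D g h))))
      = contract R D M z (tensor R D D g h) y \<odot>\<^bsub>D\<^esub> f"
    unfolding tensor_assoc_inv_tensor[OF D f g h] contract_triple[OF f g h y z]
      contract_tensor[OF M D z g h]
      D.smult_assoc1[OF dual_closed[OF h z] dual_closed[OF g y] f, symmetric]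
    by (simp only: dual_module_simps restrict_apply'[OF y])
qed

text \<open>For \<open>t\<close> the pure tensor of \<open>f\<close> and \<open>g\<close>, the two
  contractions evaluate \<open>\<Delta> g\<close> at \<open>y\<close> and \<open>z\<close>. This is
  the value of \<open>g\<close> at the product of \<open>y\<close> and \<open>z\<close>, as in one
  contraction of \<open>t\<close> with that product.\<close>

lemma contract_comult_right:
  assumes y: "y \<in> carrier M" and z: "z \<in> carrier M" and t: "t \<in> carrier DD"
  shows "contract R D M y (contract R DD M z (tensor_assoc_inv R D (tensor_map R D D D DD id \<Delta> t)))
    = contract R D M (\<mu> (tensor R M M y z)) t"
proof -
  note yz = module_hom_closedD[OF \<mu> tensor_closed[OF M M y z]]
  show ?thesis
  proof (rule tensor_hom_eqI[OF D D D module_hom_compose[OF right_hom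
          module_hom_compose[OF contract_DD_hom[OF z] contract_D_hom[OF y]]] contract_D_hom[OF yz] _ t])
    fix f g assume f: "f \<in> carrier D" and g: "g \<in> carrier D"
    show "contract R D M y (contract R DD M z (tensor_assoc_inv R D (tensor_map R D D D DD id \<Delta> (tensor R D D f g))))
        = contract R D M (\<mu> (tensor R M M y z)) (tensor R D D f g)"
      unfolding tensor_map_tensor[OF D D D DD module_hom_id comult_hom f g]
      unfolding id_apply contract_assoc_inv[OF f comult_closed[OF g] y z] contract_comult[OF M basis \<mu> g y z]
        contract_tensor[OF M D yz f g] ..
  qed
qed

lemma coassociator_closed:
  assumes f: "f \<in> carrier D"
  shows "coassociator R D \<Delta> f \<in> carrier (tensor_cube R D)"
proof -
  interpret C: module R "tensor_cube R D" by (rule cube)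
  show ?thesis
    unfolding coassociator_def
    by (intro C.M.minus_closed module_hom_closedD[OF left_hom] module_hom_closedD[OF right_hom] comult_closed f)
qed

text \<open>Each half uses \<open>contract_comult\<close> with \<open>f\<close> and a product vector
  as one argument. On the left, \<Delta> is evaluated first at \<open>x\<close> and
  \<open>y\<close>, which places their product in the first slot of \<open>\<Delta> f\<close>; on
  the right, the product of \<open>y\<close> and \<open>z\<close> fills the second slot.\<close>

lemma cube_eval_coassociator:
  assumes f: "f \<in> carrier D" and x: "x \<in> carrier M" and y: "y \<in> carrier M" and z: "z \<in> carrier M"
  shows "cube_eval R M x y z (coassociator R D \<Delta> f) = f (associator R M \<mu> (tensor_triple R M x y z))"
proof -
  note \<Delta>f = comult_closed[OF f]
  note xy = module_hom_closedD[OF \<mu> tensor_closed[OF M M x y]]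
    and yz = module_hom_closedD[OF \<mu> tensor_closed[OF M M y z]]
  note xy_z = module_hom_closedD[OF \<mu> tensor_closed[OF M M xy z]]
    and x_yz = module_hom_closedD[OF \<mu> tensor_closed[OF M M x yz]]
  have left: "cube_eval R M x y z (tensor_map R D D DD D \<Delta> id (\<Delta> f)) = f (\<mu> (tensor R M M (\<mu> (tensor R M M x y)) z))"
    unfolding cube_eval_def contract_comult_left[OF z \<Delta>f]
      contract_comult[OF M basis \<mu> module_hom_closedD[OF contract_D_hom[OF z] \<Delta>f] x y]
    by (rule contract_comult[OF M basis \<mu> f xy z])
  have right: "cube_eval R M x y z (tensor_assoc_inv R D (tensor_map R D D D DD id \<Delta> (\<Delta> f)))
      = f (\<mu> (tensor R M M x (\<mu> (tensor R M M y z))))"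
    unfolding cube_eval_def contract_comult_right[OF y z \<Delta>f]
    by (rule contract_comult[OF M basis \<mu> f x yz])
  show ?thesis
    unfolding coassociator_def associator_triple[OF M \<mu> x y z]
      module_hom_diff[OF M reg dual_hom[OF f] xy_z x_yz]
      module_hom_diff[OF cube reg cube_eval_hom[OF x y z] module_hom_closedD[OF left_hom \<Delta>f]
        module_hom_closedD[OF right_hom \<Delta>f]]
      left right ..
qed

section \<open>Alternating sums over permutations closed under inversion\<close>

context
  fixes G :: "(nat \<Rightarrow> nat) set"
  assumes permutes: "\<And>\<sigma>. \<sigma> \<in> G \<Longrightarrow> \<sigma> permutes {1, 2, 3}"
    and inverse: "\<And>\<sigma>. \<sigma> \<in> G \<Longrightarrow> inv_into UNIV \<sigma> \<in> G"
begin

text \<open>The action on a triple produces indices permuted by inverses, whereas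
  \<open>cube_eval_perm\<close> produces \<sigma> itself. Reindexing the sum along inversion, an
  involution of \<open>G\<close>, brings both sums to the same form.\<close>

lemma associator_alternating:
  fixes x :: "nat \<Rightarrow> 'b"
  assumes x: "x 1 \<in> carrier M" "x 2 \<in> carrier M" "x 3 \<in> carrier M"
  shows "associator R M \<mu> (alternating_map R M G (tensor_triple R M (x 1) (x 2) (x 3))) =
    (\<Oplus>\<^bsub>M\<^esub>\<sigma>\<in>G. [sign \<sigma>] \<cdot>\<^bsub>M\<^esub> associator R M \<mu> (tensor_triple R M (x (\<sigma> 1)) (x (\<sigma> 2)) (x (\<sigma> 3))))"
    (is "_ = (\<Oplus>\<^bsub>M\<^esub>\<sigma>\<in>G. ?a \<sigma>)")
proof -
  note C = tensor_cube_module[OF M] and A = associator_hom[OF M \<mu>]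
  have triple: "tensor_triple R M (x (\<sigma> 1)) (x (\<sigma> 2)) (x (\<sigma> 3)) \<in> carrier (tensor_cube R M)" if "\<sigma> \<in> G" for \<sigma>
    by (rule tensor_triple_closed[OF M permutes_3_point[where x = x, OF permutes[OF that] x]])
  have a: "?a \<sigma> \<in> carrier M" if "\<sigma> \<in> G" for \<sigma>
    by (rule int_multiple_closed[OF M module_hom_closedD[OF A triple[OF that]]])
  have perm: "perm_map R M \<sigma> (tensor_triple R M (x 1) (x 2) (x 3)) \<in> carrier (tensor_cube R M)" if "\<sigma> \<in> G" for \<sigma>
    unfolding perm_map_triple[where x = x, OF M permutes[OF that] x] by (rule triple[OF inverse[OF that]])
  have "associator R M \<mu> (alternating_map R M G (tensor_triple R M (x 1) (x 2) (x 3)))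
      = (\<Oplus>\<^bsub>M\<^esub>\<sigma>\<in>G. associator R M \<mu> ([sign \<sigma>] \<cdot>\<^bsub>tensor_cube R M\<^esub> perm_map R M \<sigma> (tensor_triple R M (x 1) (x 2) (x 3))))"
    unfolding alternating_map_def
    by (rule module_hom_finsum[OF C M A]) (intro funcsetI int_multiple_closed[OF C] perm)
  also have "\<dots> = (\<Oplus>\<^bsub>M\<^esub>\<sigma>\<in>G. ?a (inv_into UNIV \<sigma>))"
  proof (rule M.M.finsum_cong'[OF refl])
    show "(\<lambda>\<sigma>. ?a (inv_into UNIV \<sigma>)) \<in> G \<rightarrow> carrier M"
      by (intro funcsetI a inverse)
    fix \<sigma> assume \<sigma>: "\<sigma> \<in> G"
    show "associator R M \<mu> ([sign \<sigma>] \<cdot>\<^bsub>tensor_cube R M\<^esub> perm_map R M \<sigma> (tensor_triple R M (x 1) (x 2) (x 3))) = ?a (inv_into UNIV \<sigma>)"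
      unfolding module_hom_int_multiple[OF C M A perm[OF \<sigma>]]
      unfolding perm_map_triple[where x = x, OF M permutes[OF \<sigma>] x]
        sign_inv[OF permutes[OF \<sigma>] finite.insertI[OF finite.insertI[OF finite.insertI[OF finite.emptyI]]]] ..
  qed
  also have "\<dots> = (\<Oplus>\<^bsub>M\<^esub>\<sigma>\<in>inv_into UNIV ` G. ?a \<sigma>)"
  proof (rule M.M.finsum_reindex[symmetric])
    show "?a \<in> inv_into UNIV ` G \<rightarrow> carrier M"
      by (rule funcsetI) (elim imageE, simp only: a inverse)
    show "inj_on (inv_into UNIV) G"
      by (rule inj_on_inverseI[of _ "inv_into UNIV"]) (rule permutes_inv_inv[OF permutes])
  qed
  also have "inv_into UNIV ` G = G"
  proof (intro equalityI subsetI)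
    fix \<sigma> assume \<sigma>: "\<sigma> \<in> G"
    show "\<sigma> \<in> inv_into UNIV ` G"
      by (rule rev_image_eqI, rule inverse[OF \<sigma>], rule permutes_inv_inv[OF permutes[OF \<sigma>], symmetric])
  qed (elim imageE, simp only: inverse)
  finally show ?thesis .
qed

text \<open>With the indices matched, the sums agree term by term: evaluation and \<open>f\<close>
  are both linear, so each passes through the sum and the signs.\<close>

lemma cube_eval_alternating:
  fixes x :: "nat \<Rightarrow> 'b"
  assumes f: "f \<in> carrier D" and x: "x 1 \<in> carrier M" "x 2 \<in> carrier M" "x 3 \<in> carrier M"
  shows "cube_eval R M (x 1) (x 2) (x 3) (alternating_map R D G (coassociator R D \<Delta> f))
    = f (associator R M \<mu> (alternating_map R M G (tensor_triple R M (x 1) (x 2) (x 3))))"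
proof -
  note A = associator_hom[OF M \<mu>] and c = coassociator_closed[OF f]
  have x\<sigma>: "x (\<sigma> 1) \<in> carrier M" "x (\<sigma> 2) \<in> carrier M" "x (\<sigma> 3) \<in> carrier M" if "\<sigma> \<in> G" for \<sigma>
    using permutes_3_point[where x = x, OF permutes[OF that] x] .
  note E = cube_eval_hom[OF x]
  note perm = module_hom_closedD[OF perm_map_hom[OF D permutes] c]
  have a: "associator R M \<mu> (tensor_triple R M (x (\<sigma> 1)) (x (\<sigma> 2)) (x (\<sigma> 3))) \<in> carrier M" if "\<sigma> \<in> G" for \<sigma>
    by (intro module_hom_closedD[OF A] tensor_triple_closed[OF M] x\<sigma> that)
  have "abelian_monoid (regular_module R)"
    using reg by (simp add: module_def abelian_group_def)
  note cong = abelian_monoid.finsum_cong'[OF this refl]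
  have "cube_eval R M (x 1) (x 2) (x 3) (alternating_map R D G (coassociator R D \<Delta> f))
      = (\<Oplus>\<^bsub>regular_module R\<^esub>\<sigma>\<in>G. cube_eval R M (x 1) (x 2) (x 3)
          ([sign \<sigma>] \<cdot>\<^bsub>tensor_cube R D\<^esub> perm_map R D \<sigma> (coassociator R D \<Delta> f)))"
    unfolding alternating_map_def
    by (rule module_hom_finsum[OF cube reg E]) (intro funcsetI int_multiple_closed[OF cube] perm)
  also have "\<dots> = (\<Oplus>\<^bsub>regular_module R\<^esub>\<sigma>\<in>G.
      f ([sign \<sigma>] \<cdot>\<^bsub>M\<^esub> associator R M \<mu> (tensor_triple R M (x (\<sigma> 1)) (x (\<sigma> 2)) (x (\<sigma> 3)))))"
  proof (rule cong)
    show "(\<lambda>\<sigma>. f ([sign \<sigma>] \<cdot>\<^bsub>M\<^esub> associator R M \<mu> (tensor_triple R M (x (\<sigma> 1)) (x (\<sigma> 2)) (x (\<sigma> 3))))) \<in> G \<rightarrow> carrier (regular_module R)"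
      by (intro funcsetI module_hom_closedD[OF dual_hom[OF f]] int_multiple_closed[OF M] a)
    fix \<sigma> assume \<sigma>: "\<sigma> \<in> G"
    show "cube_eval R M (x 1) (x 2) (x 3) ([sign \<sigma>] \<cdot>\<^bsub>tensor_cube R D\<^esub> perm_map R D \<sigma> (coassociator R D \<Delta> f))
        = f ([sign \<sigma>] \<cdot>\<^bsub>M\<^esub> associator R M \<mu> (tensor_triple R M (x (\<sigma> 1)) (x (\<sigma> 2)) (x (\<sigma> 3))))"
      unfolding module_hom_int_multiple[OF cube reg E perm[OF \<sigma>]] module_hom_int_multiple[OF M reg dual_hom[OF f] a[OF \<sigma>]]
        cube_eval_perm[where x = x, OF permutes[OF \<sigma>] x c] cube_eval_coassociator[OF f x\<sigma>[OF \<sigma>]] ..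
  qed
  also have "\<dots> = f (\<Oplus>\<^bsub>M\<^esub>\<sigma>\<in>G. [sign \<sigma>] \<cdot>\<^bsub>M\<^esub> associator R M \<mu> (tensor_triple R M (x (\<sigma> 1)) (x (\<sigma> 2)) (x (\<sigma> 3))))"
    by (rule module_hom_finsum[OF M reg dual_hom[OF f], symmetric]) (intro funcsetI int_multiple_closed[OF M] a)
  also have "\<dots> = f (associator R M \<mu> (alternating_map R M G (tensor_triple R M (x 1) (x 2) (x 3))))"
    unfolding associator_alternating[where x = x, OF x] ..
  finally show ?thesis .
qed

lemma dual_coalgebra:
  assumes "G_associative_algebra R G M \<mu>"
  shows "G_coalgebra R G D \<Delta>"
  unfolding G_coalgebra_def
proof (intro conjI ballI D comult_hom)
  fix f assume f: "f \<in> carrier D"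
  interpret C: module R "tensor_cube R D" by (rule cube)
  have alt: "alternating_map R D G (coassociator R D \<Delta> f) \<in> carrier (tensor_cube R D)"
    unfolding alternating_map_def
    by (intro C.M.finsum_closed funcsetI int_multiple_closed[OF cube]
        module_hom_closedD[OF perm_map_hom[OF D permutes] coassociator_closed[OF f]])
  show "alternating_map R D G (coassociator R D \<Delta> f) = \<zero>\<^bsub>tensor_cube R D\<^esub>"
  \<comment> \<open>The tensor vanishes as soon as all its values do, and each value is
    \<open>f\<close> applied to an associator that is zero by assumption.\<close>
  proof (rule cube_eval_eqI[OF basis alt C.M.zero_closed])
    fix x y z assume xyz: "x \<in> carrier M" "y \<in> carrier M" "z \<in> carrier M"
    define v where "v k = [x, y, z] ! (k - 1)" for k :: nat
    have v_eq: "v 1 = x" "v 2 = y" "v 3 = z"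
      by (simp_all add: v_def)
    have v: "v 1 \<in> carrier M" "v 2 \<in> carrier M" "v 3 \<in> carrier M"
      unfolding v_eq by (fact xyz)+
    have "associator R M \<mu> (alternating_map R M G (tensor_triple R M x y z)) = \<zero>\<^bsub>M\<^esub>"
      using assms tensor_triple_closed[OF M xyz] unfolding G_associative_algebra_def by blast
    then have "cube_eval R M x y z (alternating_map R D G (coassociator R D \<Delta> f)) = f \<zero>\<^bsub>M\<^esub>"
      using cube_eval_alternating[where x = v, OF f v] unfolding v_eq by (simp only:)
    then show "cube_eval R M x y z (alternating_map R D G (coassociator R D \<Delta> f))
        = cube_eval R M x y z \<zero>\<^bsub>tensor_cube R D\<^esub>"
      unfolding module_hom_zero[OF M reg dual_hom[OF f]] module_hom_zero[OF cube reg cube_eval_hom[OF xyz]] .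
  qed
qed

end

end

end

text \<open>Bijectivity is asserted together with the coalgebra identity because
  \<open>dual_comult\<close> inverts the canonical map by choice; it certifies that the
  comultiplication really is the transpose of \<mu> under the identification of the two
  modules.\<close>

theorem proposition6:
  fixes R :: "('a, 'k) ring_scheme"
    and M :: "('a, 'b, 'm) module_scheme"
    and \<mu> :: "('a, 'b) tensor2 \<Rightarrow> 'b"
    and i :: nat
  assumes "cring R"
    and "i \<in> {1..6}"
    and "module R M"
    and "free_of_finite_type R M"
    and "G_associative_algebra R (sigma3_subgroup i) M \<mu>"
  shows "bij_betw (dual_tensor_map R M)
           (carrier (tensor_product R (dual_module R M) (dual_module R M)))
           (carrier (dual_module R (tensor_product R M M)))
         \<and> G_coalgebra R (sigma3_subgroup i) (dual_module R M) (dual_comult R M \<mu>)"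
proof -
  obtain B \<delta> where basis: "dual_basis R M B \<delta>"
    using free_of_finite_type_dual_basis[OF assms(3,4)] by blast
  have \<mu>: "\<mu> \<in> module_hom R (tensor_product R M M) M"
    using assms(5) by (simp add: G_associative_algebra_def)
  show ?thesis
    using dual_tensor_map_bij[OF assms(3) basis]
      dual_coalgebra[OF assms(3) basis \<mu> sigma3_subgroup_permutes[OF assms(2)]
        sigma3_subgroup_inv[OF assms(2)] assms(5)]
    by (rule conjI)
qed

end
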